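(* Under the standing assumptions of the context, as $l\to\infty$, $$|\Delta^2_{\varphi_l^{\bot}}-\Delta^2_{\varphi^M}|=O\Big(\max\big\{\mu(l),\,l\,C_0^{-l+2\log_2\frac{1+\varepsilon(l)}{c}}\big\}\Big),\qquad C_0:=\frac{32\pi^2e^{2\omega_0}}{27}.$$
   Context: Fourier transform: $\widehat f(\omega)=\int_{\mathbb{R}}f(t)e^{-it\omega}\,dt$. Let $\theta$ be odd, non-decreasing, $C^2$, with $\theta(\omega)=\pi/4$ for $\omega>\pi/3$; fix $\pi/3\le\omega_0<\pi/2$. Meyer scaling function: $\widehat{\varphi^M}(\omega)=1$ for $|\omega|\le2\omega_0$, $=\cos(\frac\pi4+\theta(\frac{\pi}{3(\pi-2\omega_0)}(|\omega|-\pi)))$ for $2\omega_0<|\omega|\le2\pi-2\omega_0$, $=0$ otherwise. Meyer mask: $2\pi$-periodic $m^M$ with $m^M(\omega)=\widehat{\varphi^M}(2\omega)$ on $[-\pi,\pi]$. $\|\cdot\|_C$: sup norm on $[-\pi,\pi]$. A linear method of summation $(\lambda_{n,k})$ maps $f$ with Fourier coefficients $a_k,b_k$ to $u_n(f,\omega)=\frac{a_0}2+\sum_{k=1}^n\lambda_{n,k}(a_k\cos k\omega+b_k\sin k\omega)$. $m^M_l:=m^M/(\cos\frac\omega2)^{2l}$. Standing assumptions: a method and a sequence $n(l)$ are fixed with $u_l:=u_{n(l)}(m^M_l,\cdot)$, $u_{1,l}:=u_{n(l)}((m^M_l)',\cdot)$ satisfying $\alpha(l):=\|u_l-m^M_l\|_C=o(l^{-1})$,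 $\gamma(l):=\|u_{1,l}-(m^M_l)'\|_C=o(1)$, $u_l(\pi)\ne0$; $l_0$ is fixed with $c:=\inf_{l\ge l_0}|u_l(0)|>0$ and $l\ge l_0$. $\varepsilon(l):=\alpha(l)/\|m^M_l\|_C$, $\mu(l):=l\alpha(l)+\gamma(l)$. $m_l(\omega):=(\cos\frac\omega2)^{2l}u_l(\omega)/u_l(0)$, $\widehat{\varphi_l}(\omega):=\prod_{j\ge1}m_l(\omega2^{-j})$, $\Phi_l(\omega):=\sum_{k}|\widehat{\varphi_l}(\omega+2\pi k)|^2$, $\widehat{\varphi_l^{\bot}}:=\widehat{\varphi_l}\Phi_l^{-1/2}$. Time radius: $\Delta_f^2=\|f\|_{L^2}^{-2}\int(t-t_{0f})^2|f(t)|^2dt$ with $t_{0f}=\|f\|_{L^2}^{-2}\int t|f(t)|^2dt$. *)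

theory Defs
  imports "HOL-Analysis.Analysis" "HOL-Library.Landau_Symbols"
begin

text \<open>Inverse Fourier transform for the convention
  hat f (w) = integral of f(t) e^(-i t w) dt, i.e.
  f(t) = (1/(2 pi)) integral of hat f (w) e^(i t w) dw.\<close>
definition inv_fourier :: "(real \<Rightarrow> complex) \<Rightarrow> real \<Rightarrow> complex" where
  "inv_fourier g t = (1 / (2 * pi)) *\<^sub>R
     (LINT w|lborel. g w * exp (\<i> * complex_of_real (t * w)))"

definition L2norm_sq :: "(real \<Rightarrow> complex) \<Rightarrow> real" where
  "L2norm_sq f = (LINT t|lborel. (cmod (f t))\<^sup>2)"

definition time_centre :: "(real \<Rightarrow> complex) \<Rightarrow> real" where
  "time_centre f = (LINT t|lborel. t * (cmod (f t))\<^sup>2) / L2norm_sq f"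

definition time_radius_sq :: "(real \<Rightarrow> complex) \<Rightarrow> real" where
  "time_radius_sq f =
     (LINT t|lborel. (t - time_centre f)\<^sup>2 * (cmod (f t))\<^sup>2) / L2norm_sq f"

definition C2_real :: "(real \<Rightarrow> real) \<Rightarrow> bool" where
  "C2_real f \<longleftrightarrow> (\<exists>f' f''. (\<forall>x. (f has_real_derivative f' x) (at x)) \<and>
      (\<forall>x. (f' has_real_derivative f'' x) (at x)) \<and> continuous_on UNIV f'')"

definition meyer_hat :: "(real \<Rightarrow> real) \<Rightarrow> real \<Rightarrow> real \<Rightarrow> real" where
  "meyer_hat \<theta> \<omega>0 \<omega> =
     (if \<bar>\<omega>\<bar> \<le> 2 * \<omega>0 then 1
      else if \<bar>\<omega>\<bar> \<le> 2 * pi - 2 * \<omega>0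
        then cos (pi / 4 + \<theta> (pi / (3 * (pi - 2 * \<omega>0)) * (\<bar>\<omega>\<bar> - pi)))
      else 0)"

definition meyer_phi :: "(real \<Rightarrow> real) \<Rightarrow> real \<Rightarrow> real \<Rightarrow> complex" where
  "meyer_phi \<theta> \<omega>0 = inv_fourier (\<lambda>\<omega>. complex_of_real (meyer_hat \<theta> \<omega>0 \<omega>))"

text \<open>Meyer mask: the 2 pi-periodic function equal to meyer_hat (2 w) on [-pi, pi]
  (the values at the endpoints agree, both being 0).\<close>
definition meyer_mask :: "(real \<Rightarrow> real) \<Rightarrow> real \<Rightarrow> real \<Rightarrow> real" where
  "meyer_mask \<theta> \<omega>0 \<omega> =
     meyer_hat \<theta> \<omega>0 (2 * (\<omega> - 2 * pi * real_of_int \<lfloor>(\<omega> + pi) / (2 * pi)\<rfloor>))"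

definition meyer_mask_l :: "(real \<Rightarrow> real) \<Rightarrow> real \<Rightarrow> nat \<Rightarrow> real \<Rightarrow> real" where
  "meyer_mask_l \<theta> \<omega>0 l \<omega> = meyer_mask \<theta> \<omega>0 \<omega> / (cos (\<omega> / 2)) ^ (2 * l)"

definition Cnorm :: "(real \<Rightarrow> real) \<Rightarrow> real" where
  "Cnorm f = (SUP \<omega>\<in>{-pi..pi}. \<bar>f \<omega>\<bar>)"

definition four_a :: "(real \<Rightarrow> real) \<Rightarrow> nat \<Rightarrow> real" where
  "four_a f k = integral {-pi..pi} (\<lambda>t. f t * cos (real k * t)) / pi"

definition four_b :: "(real \<Rightarrow> real) \<Rightarrow> nat \<Rightarrow> real" where
  "four_b f k = integral {-pi..pi} (\<lambda>t. f t * sin (real k * t)) / pi"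

definition summ_method :: "(nat \<Rightarrow> nat \<Rightarrow> real) \<Rightarrow> nat \<Rightarrow> (real \<Rightarrow> real) \<Rightarrow> real \<Rightarrow> real" where
  "summ_method lam n f \<omega> = four_a f 0 / 2 +
     (\<Sum>k=1..n. lam n k * (four_a f k * cos (real k * \<omega>) + four_b f k * sin (real k * \<omega>)))"

definition u_l :: "(real \<Rightarrow> real) \<Rightarrow> real \<Rightarrow> (nat \<Rightarrow> nat \<Rightarrow> real) \<Rightarrow> (nat \<Rightarrow> nat) \<Rightarrow> nat \<Rightarrow> real \<Rightarrow> real" where
  "u_l \<theta> \<omega>0 lam nn l = summ_method lam (nn l) (meyer_mask_l \<theta> \<omega>0 l)"

definition u1_l :: "(real \<Rightarrow> real) \<Rightarrow> real \<Rightarrow> (nat \<Rightarrow> nat \<Rightarrow> real) \<Rightarrow> (nat \<Rightarrow> nat) \<Rightarrow> nat \<Rightarrow> real \<Rightarrow> real" where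
  "u1_l \<theta> \<omega>0 lam nn l = summ_method lam (nn l) (deriv (meyer_mask_l \<theta> \<omega>0 l))"

definition alpha_l :: "(real \<Rightarrow> real) \<Rightarrow> real \<Rightarrow> (nat \<Rightarrow> nat \<Rightarrow> real) \<Rightarrow> (nat \<Rightarrow> nat) \<Rightarrow> nat \<Rightarrow> real" where
  "alpha_l \<theta> \<omega>0 lam nn l = Cnorm (\<lambda>\<omega>. u_l \<theta> \<omega>0 lam nn l \<omega> - meyer_mask_l \<theta> \<omega>0 l \<omega>)"

definition gamma_l :: "(real \<Rightarrow> real) \<Rightarrow> real \<Rightarrow> (nat \<Rightarrow> nat \<Rightarrow> real) \<Rightarrow> (nat \<Rightarrow> nat) \<Rightarrow> nat \<Rightarrow> real" where
  "gamma_l \<theta> \<omega>0 lam nn l = Cnorm (\<lambda>\<omega>. u1_l \<theta> \<omega>0 lam nn l \<omega> - deriv (meyer_mask_l \<theta> \<omega>0 l) \<omega>)"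

definition eps_l :: "(real \<Rightarrow> real) \<Rightarrow> real \<Rightarrow> (nat \<Rightarrow> nat \<Rightarrow> real) \<Rightarrow> (nat \<Rightarrow> nat) \<Rightarrow> nat \<Rightarrow> real" where
  "eps_l \<theta> \<omega>0 lam nn l = alpha_l \<theta> \<omega>0 lam nn l / Cnorm (meyer_mask_l \<theta> \<omega>0 l)"

definition mu_l :: "(real \<Rightarrow> real) \<Rightarrow> real \<Rightarrow> (nat \<Rightarrow> nat \<Rightarrow> real) \<Rightarrow> (nat \<Rightarrow> nat) \<Rightarrow> nat \<Rightarrow> real" where
  "mu_l \<theta> \<omega>0 lam nn l = real l * alpha_l \<theta> \<omega>0 lam nn l + gamma_l \<theta> \<omega>0 lam nn l"

definition mask_l :: "(real \<Rightarrow> real) \<Rightarrow> real \<Rightarrow> (nat \<Rightarrow> nat \<Rightarrow> real) \<Rightarrow> (nat \<Rightarrow> nat) \<Rightarrow> nat \<Rightarrow> real \<Rightarrow> real" where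
  "mask_l \<theta> \<omega>0 lam nn l \<omega> =
     (cos (\<omega> / 2)) ^ (2 * l) * u_l \<theta> \<omega>0 lam nn l \<omega> / u_l \<theta> \<omega>0 lam nn l 0"

definition phi_hat_l :: "(real \<Rightarrow> real) \<Rightarrow> real \<Rightarrow> (nat \<Rightarrow> nat \<Rightarrow> real) \<Rightarrow> (nat \<Rightarrow> nat) \<Rightarrow> nat \<Rightarrow> real \<Rightarrow> real" where
  "phi_hat_l \<theta> \<omega>0 lam nn l \<omega> = (\<Prod>j. mask_l \<theta> \<omega>0 lam nn l (\<omega> / 2 ^ Suc j))"

definition Phi_l :: "(real \<Rightarrow> real) \<Rightarrow> real \<Rightarrow> (nat \<Rightarrow> nat \<Rightarrow> real) \<Rightarrow> (nat \<Rightarrow> nat) \<Rightarrow> nat \<Rightarrow> real \<Rightarrow> real" where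
  "Phi_l \<theta> \<omega>0 lam nn l \<omega> =
     (\<Sum>\<^sub>\<infinity>k\<in>(UNIV::int set). (phi_hat_l \<theta> \<omega>0 lam nn l (\<omega> + 2 * pi * real_of_int k))\<^sup>2)"

definition phi_orth_hat_l :: "(real \<Rightarrow> real) \<Rightarrow> real \<Rightarrow> (nat \<Rightarrow> nat \<Rightarrow> real) \<Rightarrow> (nat \<Rightarrow> nat) \<Rightarrow> nat \<Rightarrow> real \<Rightarrow> real" where
  "phi_orth_hat_l \<theta> \<omega>0 lam nn l \<omega> =
     phi_hat_l \<theta> \<omega>0 lam nn l \<omega> / sqrt (Phi_l \<theta> \<omega>0 lam nn l \<omega>)"

definition phi_orth_l :: "(real \<Rightarrow> real) \<Rightarrow> real \<Rightarrow> (nat \<Rightarrow> nat \<Rightarrow> real) \<Rightarrow> (nat \<Rightarrow> nat) \<Rightarrow> nat \<Rightarrow> real \<Rightarrow> complex" where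
  "phi_orth_l \<theta> \<omega>0 lam nn l =
     inv_fourier (\<lambda>\<omega>. complex_of_real (phi_orth_hat_l \<theta> \<omega>0 lam nn l \<omega>))"

definition C0_const :: "real \<Rightarrow> real" where
  "C0_const \<omega>0 = 32 * pi\<^sup>2 * exp (2 * \<omega>0) / 27"

end

theory Submission
  imports Defs "HOL-Probability.Probability"
begin

text \<open>
  The Fourier transforms in question are real, so the time centres vanish and Plancherel's theorem gives
  \<open>\<Delta>\<^sup>2 = (\<integral> g'\<^sup>2) / (\<integral> g\<^sup>2)\<close> for \<open>g\<close> the transform of the function. It therefore suffices to compare the two
  transforms and their derivatives, up to \<open>O(\<mu>(l) / (1 + \<omega>\<^sup>2))\<close>, which yields a bound \<open>O(\<mu>(l))\<close>.

  The masks and their derivatives differ by \<open>O(\<mu>(l))\<close>, because the derivative of \<open>u\<^sub>l\<close> is \<open>u\<^sub>1\<^sub>,\<^sub>l\<close>.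
  Near 0 the infinite product is the exponential of a sum of logarithms of size \<open>O(\<mu>(l))\<close>. Away from 0 every
  orbit of the doubling map enters \<open>cos \<omega> \<le> - 1 / 2\<close>, where the Meyer mask vanishes and the new mask is
  \<open>O(\<mu>(l) (cos (\<omega> / 2))\<^sup>4)\<close>; a weight adapted to the doubling map turns this into quadratic decay with a
  factor \<open>\<mu>(l)\<close>. Periodizing, \<open>\<Phi>\<^sub>l = 1 + O(\<mu>(l))\<close> together with its derivative, so orthogonalization
  preserves the estimates.
\<close>

section \<open>Plancherel's theorem and the time radius\<close>

text \<open>The obstacle is the region away from 0. On most of the circle a perturbed mask is only
  known to be bounded by 1 plus a small error, so iterating the refinement equation yields neither
  decay nor a factor \<open>mu(l)\<close>. Both must come from the zone
  \<open>cos x \<le> - 1 / 2\<close>, where the Meyer mask vanishes because omega0 is at least pi /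
  3. The edge of this zone, 2 pi / 3 and 4 pi / 3, is a cycle of the doubling map, and the natural
  weight \<open>sin (x / 2) ^ 4\<close> does not grow along it; this is why the weight carries an
  extra factor inside the zone. The factor l in \<open>mu(l)\<close> arises on differentiating the
  power of the cosine: this brings down l and loses one power of \<open>(1 + cos x) / 2\<close>,
  which is harmless since that quantity is at least 1 / 4 wherever the Meyer mask is nonzero. One
  envelope \<open>K / (1 + x^2)\<close> serves everywhere: it is integrable, summable over shifts by
  2 pi and stable under sums and products.\<close>

definition fourier_int :: "(real \<Rightarrow> real) \<Rightarrow> real \<Rightarrow> complex" where
  "fourier_int g t = (LINT w|lborel. complex_of_real (g w) * cis (t * w))"

lemma integrable_inverse_one_plus_square: "integrable lborel (\<lambda>x::real. K / (1 + x\<^sup>2))"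
proof -
  have "integrable lborel (\<lambda>x::real. inverse (1 + x\<^sup>2))"
    using integrable_inverse_1_plus_square
    by (simp add: einterval_eq set_integrable_def)
  then have "integrable lborel (\<lambda>x::real. K * inverse (1 + x\<^sup>2))"
    by simp
  then show ?thesis by (simp add: divide_inverse)
qed

lemma integrable_decay:
  fixes g :: "real \<Rightarrow> real"
  assumes "continuous_on UNIV g" "\<And>x. \<bar>g x\<bar> \<le> K / (1 + x\<^sup>2)"
  shows "integrable lborel g"
proof (rule Bochner_Integration.integrable_bound[OF integrable_inverse_one_plus_square[of K]])
  show "g \<in> borel_measurable lborel"
    using borel_measurable_continuous_onI[OF assms(1)] by simp
  have "norm (g x) \<le> norm (K / (1 + x\<^sup>2))" for x
    using order_trans[OF assms(2)[of x] abs_ge_self] by simp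
  then show "AE x in lborel. norm (g x) \<le> norm (K / (1 + x\<^sup>2))" by simp
qed

lemma decay_bounded:
  fixes g :: "real \<Rightarrow> real"
  assumes "\<And>x. \<bar>g x\<bar> \<le> K / (1 + x\<^sup>2)"
  shows "\<bar>g x\<bar> \<le> K" "0 \<le> K"
proof -
  show K: "0 \<le> K" using assms[of 0] by simp
  have "K / (1 + x\<^sup>2) \<le> K / 1" by (rule divide_left_mono) (use K in \<open>auto simp: add_pos_nonneg\<close>)
  then show "\<bar>g x\<bar> \<le> K" using assms[of x] by simp
qed

lemma integrable_fourier_int:
  fixes g :: "real \<Rightarrow> real"
  assumes "integrable lborel g"
  shows "integrable lborel (\<lambda>w. complex_of_real (g w) * cis (t * w))"
proof (rule Bochner_Integration.integrable_bound[OF assms])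
  have "(\<lambda>w. cis (t * w)) \<in> borel_measurable borel"
    by (intro borel_measurable_continuous_onI continuous_intros)
  then show "(\<lambda>w. complex_of_real (g w) * cis (t * w)) \<in> borel_measurable lborel"
    using borel_measurable_integrable[OF assms] by simp
qed (simp add: norm_mult)

lemma integrable_pair_mult:
  fixes g h :: "real \<Rightarrow> real"
  assumes "integrable lborel g" "integrable lborel h"
  shows "integrable (lborel \<Otimes>\<^sub>M lborel) (\<lambda>p. g (fst p) * h (snd p))"
proof -
  have [measurable]: "g \<in> borel_measurable borel" "h \<in> borel_measurable borel"
    using assms[THEN borel_measurable_integrable] by auto
  show ?thesis
    by (rule lborel_pair.Fubini_integrable) (use assms in \<open>auto simp: abs_mult\<close>)
qed

text \<open>This is \<open>F * cnj F\<close> as a double integral in \<open>(w, v)\<close>: the real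
  part of \<open>cis (t * w) * cnj (cis (t * v))\<close> is \<open>cos (t * (w - v))\<close>. The
  variable \<open>t\<close> is now confined to the cosine and can be integrated out first.\<close>

lemma norm_fourier_int_square:
  fixes g :: "real \<Rightarrow> real"
  assumes g: "integrable lborel g"
  shows "(cmod (fourier_int g t))\<^sup>2 =
    (LINT p|(lborel \<Otimes>\<^sub>M lborel). g (fst p) * g (snd p) * cos (t * (fst p - snd p)))"
proof -
  have [measurable]: "g \<in> borel_measurable borel"
    using g[THEN borel_measurable_integrable] by auto
  let ?F = "fourier_int g t"
  have I: "integrable (lborel \<Otimes>\<^sub>M lborel) (\<lambda>p. g (fst p) * g (snd p) * cos (t * (fst p - snd p)))"
    by (rule Bochner_Integration.integrable_bound[OF integrable_pair_mult[OF g g]])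
       (auto simp: abs_mult intro!: mult_left_le)
  have inner: "(LINT v|lborel. g v * cos (t * (w - v))) = Re (cis (t * w) * cnj ?F)" for w
  proof -
    have "cnj ?F = (LINT v|lborel. cnj (complex_of_real (g v) * cis (t * v)))"
      unfolding fourier_int_def by (rule Bochner_Integration.integral_cnj[symmetric])
    then have "cis (t * w) * cnj ?F =
        (LINT v|lborel. cis (t * w) * cnj (complex_of_real (g v) * cis (t * v)))"
      by simp
    also have "Re \<dots> = (LINT v|lborel. Re (cis (t * w) * cnj (complex_of_real (g v) * cis (t * v))))"
      using integrable_fourier_int[OF g, of t]
      by (intro integral_Re[symmetric] integrable_mult_right) (subst integrable_cnj, auto)
    also have "\<dots> = (LINT v|lborel. g v * cos (t * (w - v)))"
      by (intro Bochner_Integration.integral_cong refl) (simp add: right_diff_distrib cos_diff algebra_simps)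
    finally show ?thesis ..
  qed
  have "(LINT p|(lborel \<Otimes>\<^sub>M lborel). g (fst p) * g (snd p) * cos (t * (fst p - snd p)))
     = (LINT w|lborel. LINT v|lborel. g w * g v * cos (t * (w - v)))"
    using lborel_pair.integral_fst'[OF I] by simp
  also have "\<dots> = (LINT w|lborel. g w * Re (cis (t * w) * cnj ?F))"
    unfolding inner[symmetric] by (simp add: mult.assoc)
  also have "\<dots> = (LINT w|lborel. Re (complex_of_real (g w) * cis (t * w) * cnj ?F))"
    by (intro Bochner_Integration.integral_cong refl) (simp add: algebra_simps)
  also have "\<dots> = Re (LINT w|lborel. complex_of_real (g w) * cis (t * w) * cnj ?F)"
    using integrable_fourier_int[OF g, of t] by (intro integral_Re) simp
  also have "(LINT w|lborel. complex_of_real (g w) * cis (t * w) * cnj ?F) = ?F * cnj ?F"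
    unfolding fourier_int_def[of g t] by simp
  also have "Re \<dots> = (cmod ?F)\<^sup>2"
    by (metis Re_complex_of_real complex_norm_square)
  finally show ?thesis ..
qed

text \<open>The real part of the characteristic function of the standard normal distribution,
  multiplied by the normalizing factor \<open>sqrt (2 * pi)\<close> of its density.\<close>

lemma gaussian_cos:
  shows "integrable lborel (\<lambda>x::real. exp (- x\<^sup>2 / 2) * cos (x * s))"
    and "(LINT x|lborel. exp (- x\<^sup>2 / 2) * cos (x * s)) = sqrt (2 * pi) * exp (- s\<^sup>2 / 2)"
proof -
  interpret D: real_distribution std_normal_distribution by (rule real_dist_normal_dist)
  have e: "exp (- x\<^sup>2 / 2) = sqrt (2 * pi) * std_normal_density x" for x :: real
    by (simp add: std_normal_density_def)
  have i: "integrable lborel std_normal_density" by simp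
  have *: "integrable lborel (\<lambda>x. std_normal_density x * cos (x * s))"
    by (rule Bochner_Integration.integrable_bound[OF i]) (auto simp: abs_mult intro!: mult_left_le)
  then show "integrable lborel (\<lambda>x::real. exp (- x\<^sup>2 / 2) * cos (x * s))"
    unfolding e mult.assoc by (rule integrable_mult_right)
  have "exp (- s\<^sup>2 / 2) = Re (char std_normal_distribution s)"
    by (simp add: char_std_normal_distribution)
  also have "\<dots> = Re (LINT x|std_normal_distribution. iexp (s * x))"
    by (simp add: char_def)
  also have "\<dots> = (LINT x|std_normal_distribution. Re (iexp (s * x)))"
    by (rule integral_Re[symmetric], rule D.integrable_const_bound[of _ 1]) auto
  also have "\<dots> = (LINT x|lborel. std_normal_density x * cos (x * s))"
    by (subst integral_density) (auto simp: mult.commute Re_exp)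
  finally show "(LINT x|lborel. exp (- x\<^sup>2 / 2) * cos (x * s)) = sqrt (2 * pi) * exp (- s\<^sup>2 / 2)"
    unfolding e mult.assoc by simp
qed

lemma gaussian_cos_scaled:
  fixes d :: real
  assumes "d > 0"
  shows "integrable lborel (\<lambda>x::real. exp (- (d * x)\<^sup>2 / 2) * cos (x * s))"
    and "(LINT x|lborel. exp (- (d * x)\<^sup>2 / 2) * cos (x * s)) = sqrt (2 * pi) / d * exp (- (s / d)\<^sup>2 / 2)"
proof -
  \<comment> \<open>The summand 0 gives the integrand the shape \<open>f (t + c * x)\<close>
    required by the affine substitution rule.\<close>
  have e: "exp (- (d * x)\<^sup>2 / 2) * cos (x * s) = exp (- (0 + d * x)\<^sup>2 / 2) * cos ((0 + d * x) * (s / d))" for x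
    using assms by simp
  show "integrable lborel (\<lambda>x::real. exp (- (d * x)\<^sup>2 / 2) * cos (x * s))"
    unfolding e using assms
    by (intro lborel_integrable_real_affine[OF gaussian_cos(1)[of "s / d"]]) auto
  have "sqrt (2 * pi) * exp (- (s / d)\<^sup>2 / 2) = \<bar>d\<bar> *\<^sub>R (LINT x|lborel. exp (- (0 + d * x)\<^sup>2 / 2) * cos ((0 + d * x) * (s / d)))"
    unfolding gaussian_cos(2)[symmetric] using assms by (intro lborel_integral_real_affine) auto
  then show "(LINT x|lborel. exp (- (d * x)\<^sup>2 / 2) * cos (x * s)) = sqrt (2 * pi) / d * exp (- (s / d)\<^sup>2 / 2)"
    unfolding e using assms by (simp add: field_simps)
qed

text \<open>The Gaussian damping makes the triple integral in \<open>(t, w, v)\<close> absolutely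
  convergent, so Fubini allows \<open>t\<close> to be integrated first. What remains is a Gaussian
  kernel of width \<open>d\<close> and total mass \<open>2 * pi\<close> in \<open>v\<close>; the
  substitution \<open>v = w + d * s\<close> moves \<open>d\<close> into the argument of
  \<open>g\<close>.\<close>

lemma gaussian_fourier_int_square:
  fixes g :: "real \<Rightarrow> real" and d :: real
  assumes g: "integrable lborel g" and d: "d > 0"
  shows "integrable lborel (\<lambda>t. exp (- (d * t)\<^sup>2 / 2) * (cmod (fourier_int g t))\<^sup>2)"
    and "(LINT t|lborel. exp (- (d * t)\<^sup>2 / 2) * (cmod (fourier_int g t))\<^sup>2) =
      (LINT w|lborel. g w * (LINT s|lborel. g (w + d * s) * (sqrt (2 * pi) * exp (- s\<^sup>2 / 2))))"
proof -
  have [measurable]: "g \<in> borel_measurable borel"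
    using g[THEN borel_measurable_integrable] by auto
  let ?P = "lborel \<Otimes>\<^sub>M lborel :: (real \<times> real) measure"
  interpret P: pair_sigma_finite lborel ?P ..
  let ?f = "\<lambda>(t, p). exp (- (d * t)\<^sup>2 / 2) * (g (fst p) * g (snd p) * cos (t * (fst p - snd p)))"
  have e1: "integrable lborel (\<lambda>t. exp (- (d * t)\<^sup>2 / 2))"
    using gaussian_cos_scaled(1)[OF d, of 0] by simp
  have bd: "integrable (lborel \<Otimes>\<^sub>M ?P) (\<lambda>(t, p). exp (- (d * t)\<^sup>2 / 2) * (g (fst p) * g (snd p)))"
    by (rule P.Fubini_integrable) (use e1 integrable_pair_mult[OF g g] in \<open>auto simp: abs_mult\<close>)
  have I: "integrable (lborel \<Otimes>\<^sub>M ?P) ?f"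
    by (rule Bochner_Integration.integrable_bound[OF bd])
       (auto simp: abs_mult case_prod_beta intro!: AE_I2 mult_left_le mult_left_mono)
  have inner: "(LINT p|?P. ?f (t, p)) = exp (- (d * t)\<^sup>2 / 2) * (cmod (fourier_int g t))\<^sup>2" for t
    by (simp add: norm_fourier_int_square[OF g])
  show "integrable lborel (\<lambda>t. exp (- (d * t)\<^sup>2 / 2) * (cmod (fourier_int g t))\<^sup>2)"
    using P.integrable_fst'[OF I] unfolding inner .
  have outer: "(LINT t|lborel. ?f (t, p)) =
      g (fst p) * g (snd p) * (sqrt (2 * pi) / d * exp (- ((fst p - snd p) / d)\<^sup>2 / 2))" for p
    unfolding gaussian_cos_scaled(2)[OF d, symmetric] by (simp add: algebra_simps flip: integral_mult_right_zero)
  have "(LINT t|lborel. exp (- (d * t)\<^sup>2 / 2) * (cmod (fourier_int g t))\<^sup>2) = (LINT t|lborel. LINT p|?P. ?f (t, p))"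
    unfolding inner ..
  also have "\<dots> = (LINT p|?P. LINT t|lborel. ?f (t, p))"
    using P.Fubini_integral[of "\<lambda>t p. ?f (t, p)"] I by simp
  also have "\<dots> = (LINT p|?P. g (fst p) * g (snd p) * (sqrt (2 * pi) / d * exp (- ((fst p - snd p) / d)\<^sup>2 / 2)))"
    unfolding outer ..
  also have "\<dots> = (LINT w|lborel. LINT v|lborel. g w * g v * (sqrt (2 * pi) / d * exp (- ((w - v) / d)\<^sup>2 / 2)))"
  proof -
    have "integrable ?P (\<lambda>p. LINT t|lborel. ?f (t, p))"
      using P.integrable_snd[of "\<lambda>t p. ?f (t, p)"] I by simp
    from lborel_pair.integral_fst'[OF this] show ?thesis unfolding outer fst_conv snd_conv by (rule sym)
  qed
  also have "\<dots> = (LINT w|lborel. g w * (LINT s|lborel. g (w + d * s) * (sqrt (2 * pi) * exp (- s\<^sup>2 / 2))))"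
  proof (rule Bochner_Integration.integral_cong[OF refl])
    fix w
    have "(LINT v|lborel. g w * g v * (sqrt (2 * pi) / d * exp (- ((w - v) / d)\<^sup>2 / 2)))
      = \<bar>d\<bar> *\<^sub>R (LINT s|lborel. g w * g (w + d * s) * (sqrt (2 * pi) / d * exp (- ((w - (w + d * s)) / d)\<^sup>2 / 2)))"
      using d by (intro lborel_integral_real_affine) auto
    also have "\<dots> = g w * (LINT s|lborel. g (w + d * s) * (sqrt (2 * pi) * exp (- s\<^sup>2 / 2)))"
      using d by (simp flip: integral_mult_right_zero integral_mult_left_zero) (simp add: mult_ac)
    finally show "(LINT v|lborel. g w * g v * (sqrt (2 * pi) / d * exp (- ((w - v) / d)\<^sup>2 / 2))) = \<dots>" .
  qed
  finally show "(LINT t|lborel. exp (- (d * t)\<^sup>2 / 2) * (cmod (fourier_int g t))\<^sup>2) =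
      (LINT w|lborel. g w * (LINT s|lborel. g (w + d * s) * (sqrt (2 * pi) * exp (- s\<^sup>2 / 2))))" .
qed

text \<open>The damping is removed by letting \<open>d\<close> decrease to 0 in the preceding
  identity. The left side increases, so monotone convergence gives integrability and value together;
  the right side converges by dominated convergence, since \<open>g\<close> is continuous, bounded
  and integrable.\<close>

lemma plancherel_decay:
  fixes g :: "real \<Rightarrow> real"
  assumes cont: "continuous_on UNIV g" and dec: "\<And>x. \<bar>g x\<bar> \<le> K / (1 + x\<^sup>2)"
  shows "integrable lborel (\<lambda>t. (cmod (fourier_int g t))\<^sup>2)"
    and "(LINT t|lborel. (cmod (fourier_int g t))\<^sup>2) = 2 * pi * (LINT w|lborel. (g w)\<^sup>2)"
proof -
  have g: "integrable lborel g" by (rule integrable_decay[OF cont dec])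
  have [measurable]: "g \<in> borel_measurable borel"
    using g[THEN borel_measurable_integrable] by auto
  have bd: "\<bar>g x\<bar> \<le> K" for x by (rule decay_bounded(1)[OF dec])
  define d where "d n = 1 / real (Suc n)" for n
  have d0: "d n > 0" for n by (simp add: d_def)
  have dlim: "d \<longlonglongrightarrow> 0" unfolding d_def by (rule LIMSEQ_Suc[OF lim_1_over_n])
  define k where "k s = sqrt (2 * pi) * exp (- s\<^sup>2 / 2)" for s :: real
  have k0: "k s \<ge> 0" for s by (simp add: k_def)
  have ki: "integrable lborel k" "(LINT s|lborel. k s) = 2 * pi"
    using gaussian_cos[of 0] by (simp_all add: k_def[abs_def] flip: real_sqrt_mult)
  have [measurable]: "k \<in> borel_measurable borel"
    using ki(1)[THEN borel_measurable_integrable] by auto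
  have inner_bd: "\<bar>LINT s|lborel. g (w + d n * s) * k s\<bar> \<le> K * (2 * pi)" for n w
  proof -
    have le: "\<bar>g (w + d n * s) * k s\<bar> \<le> K * k s" for s
      by (auto simp: abs_mult k0 bd intro!: mult_right_mono)
    have i: "integrable lborel (\<lambda>s. g (w + d n * s) * k s)"
      by (rule Bochner_Integration.integrable_bound[of lborel "\<lambda>s. K * k s"])
         (use ki order_trans[OF le abs_ge_self] in auto)
    have "\<bar>LINT s|lborel. g (w + d n * s) * k s\<bar> \<le> (LINT s|lborel. K * k s)"
      by (rule Bochner_Integration.integral_abs_bound_integral[OF i]) (use ki le in auto)
    then show ?thesis by (simp add: ki)
  qed
  have inner_lim: "(\<lambda>n. LINT s|lborel. g (w + d n * s) * k s) \<longlonglongrightarrow> g w * (2 * pi)" for w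
  proof -
    have "(\<lambda>n. LINT s|lborel. g (w + d n * s) * k s) \<longlonglongrightarrow> (LINT s|lborel. g w * k s)"
    proof (rule integral_dominated_convergence[where w="\<lambda>s. K * k s"])
      have "(\<lambda>n. g (w + d n * s) * k s) \<longlonglongrightarrow> g (w + 0 * s) * k s" for s
        by (intro tendsto_intros continuous_on_tendsto_compose[OF cont] dlim) auto
      then show "AE s in lborel. (\<lambda>n. g (w + d n * s) * k s) \<longlonglongrightarrow> g w * k s" by simp
      show "AE x in lborel. norm (g (w + d n * x) * k x) \<le> K * k x" for n
        by (auto simp: abs_mult k0 bd intro!: mult_right_mono)
    qed (auto simp: ki)
    then show ?thesis by (simp add: ki)
  qed
  have lim: "(\<lambda>n. LINT w|lborel. g w * (LINT s|lborel. g (w + d n * s) * k s)) \<longlonglongrightarrow>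
    (LINT w|lborel. g w * (g w * (2 * pi)))"
  proof (rule integral_dominated_convergence[where w="\<lambda>w. \<bar>g w\<bar> * (K * (2 * pi))"])
    show "AE w in lborel. (\<lambda>n. g w * (LINT s|lborel. g (w + d n * s) * k s)) \<longlonglongrightarrow> g w * (g w * (2 * pi))"
      by (auto intro!: tendsto_intros inner_lim)
    show "AE w in lborel. norm (g w * (LINT s|lborel. g (w + d n * s) * k s)) \<le> \<bar>g w\<bar> * (K * (2 * pi))" for n
      using inner_bd by (auto simp: abs_mult intro!: mult_left_mono)
  qed (use g in \<open>auto\<close>)
  then have lim': "(\<lambda>n. LINT t|lborel. exp (- (d n * t)\<^sup>2 / 2) * (cmod (fourier_int g t))\<^sup>2) \<longlonglongrightarrow>
      2 * pi * (LINT w|lborel. (g w)\<^sup>2)"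
    unfolding gaussian_fourier_int_square(2)[OF g d0] k_def
    by (simp add: power2_eq_square mult_ac flip: integral_mult_right_zero)
  have mono: "mono (\<lambda>n. exp (- (d n * t)\<^sup>2 / 2) * (cmod (fourier_int g t))\<^sup>2)" for t
  proof (intro monoI mult_right_mono)
    fix i j :: nat assume "i \<le> j"
    then have "d j \<le> d i" by (simp add: d_def frac_le)
    then have "(d j)\<^sup>2 * t\<^sup>2 \<le> (d i)\<^sup>2 * t\<^sup>2"
      using d0[of j] by (intro mult_right_mono power_mono) auto
    then show "exp (- (d i * t)\<^sup>2 / 2) \<le> exp (- (d j * t)\<^sup>2 / 2)"
      by (simp add: power_mult_distrib)
  qed simp
  have pt: "(\<lambda>n. exp (- (d n * t)\<^sup>2 / 2) * (cmod (fourier_int g t))\<^sup>2) \<longlonglongrightarrow> (cmod (fourier_int g t))\<^sup>2" for t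
  proof -
    have "(\<lambda>n. exp (- (d n * t)\<^sup>2 / 2) * (cmod (fourier_int g t))\<^sup>2) \<longlonglongrightarrow> exp (- (0 * t)\<^sup>2 / 2) * (cmod (fourier_int g t))\<^sup>2"
      by (intro tendsto_intros dlim) auto
    then show ?thesis by simp
  qed
  have meas: "(\<lambda>t. (cmod (fourier_int g t))\<^sup>2) \<in> borel_measurable lborel"
    by (rule borel_measurable_LIMSEQ_real[OF pt])
       (use borel_measurable_integrable[OF gaussian_fourier_int_square(1)[OF g d0]] in auto)
  note mc = integral_monotone_convergence_nonneg[OF gaussian_fourier_int_square(1)[OF g d0] _ _ _ lim' meas]
  show "integrable lborel (\<lambda>t. (cmod (fourier_int g t))\<^sup>2)"
    by (rule mc(1)) (use mono pt in auto)
  show "(LINT t|lborel. (cmod (fourier_int g t))\<^sup>2) = 2 * pi * (LINT w|lborel. (g w)\<^sup>2)"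
    by (rule mc(2)) (use mono pt in auto)
qed

lemma decay_tendsto_0:
  fixes g :: "real \<Rightarrow> real"
  assumes dec: "\<And>x. \<bar>g x\<bar> \<le> K / (1 + x\<^sup>2)"
  shows "(g \<longlongrightarrow> 0) at_top" "(g \<longlongrightarrow> 0) at_bot"
proof -
  have "((\<lambda>x::real. K / (1 + x\<^sup>2)) \<longlongrightarrow> 0) at_top" "((\<lambda>x::real. K / (1 + x\<^sup>2)) \<longlongrightarrow> 0) at_bot"
    by (intro tendsto_divide_0[OF tendsto_const] filterlim_at_top_imp_at_infinity
        filterlim_tendsto_add_at_top[OF tendsto_const] filterlim_pow_at_top filterlim_pow_at_bot_even
        filterlim_ident; simp)+
  then show "(g \<longlongrightarrow> 0) at_top" "(g \<longlongrightarrow> 0) at_bot"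
    using dec by (auto intro!: Lim_null_comparison[of g "\<lambda>x. K / (1 + x\<^sup>2)"])
qed

text \<open>Integration by parts: \<open>g w * cis (t * w)\<close> tends to 0 at both ends and its
  derivative is integrable, so that derivative has integral 0. The identity trades the factor
  \<open>t\<close> in the time radius for the derivative of the transform.\<close>

lemma fourier_int_deriv:
  fixes g g1 :: "real \<Rightarrow> real"
  assumes der: "\<And>x. (g has_real_derivative g1 x) (at x)" and cont1: "continuous_on UNIV g1"
    and dec: "\<And>x. \<bar>g x\<bar> \<le> K / (1 + x\<^sup>2)" and dec1: "\<And>x. \<bar>g1 x\<bar> \<le> K / (1 + x\<^sup>2)"
  shows "fourier_int g1 t = - \<i> * complex_of_real t * fourier_int g t"
proof -
  have cont: "continuous_on UNIV g"
    using der by (meson DERIV_isCont continuous_at_imp_continuous_on)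
  note gi = integrable_fourier_int[OF integrable_decay[OF cont dec], of t]
  note g1i = integrable_fourier_int[OF integrable_decay[OF cont1 dec1], of t]
  let ?f = "\<lambda>w. complex_of_real (g1 w) * cis (t * w) + \<i> * complex_of_real t * (complex_of_real (g w) * cis (t * w))"
  let ?F = "\<lambda>w. complex_of_real (g w) * cis (t * w)"
  have lim: "(?F \<longlongrightarrow> 0) at_top" "(?F \<longlongrightarrow> 0) at_bot"
    using decay_tendsto_0[OF dec, THEN tendsto_norm]
    by (auto intro!: tendsto_norm_zero_cancel[of ?F] simp: norm_mult)
  have "(LBINT x=-\<infinity>..\<infinity>. ?f x) = 0 - 0"
  proof (rule interval_integral_FTC_integrable[where F="?F"])
    fix x
    have "((\<lambda>w. cis (t * w)) has_vector_derivative t *\<^sub>R (\<i> * cis (t * x))) (at x)"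
      unfolding has_vector_derivative_def
      by (auto intro!: derivative_eq_intros simp: fun_eq_iff scaleR_conv_of_real)
    moreover have "((\<lambda>w. complex_of_real (g w)) has_vector_derivative complex_of_real (g1 x)) (at x)"
      using der[of x] by (simp add: has_real_derivative_iff_has_vector_derivative has_vector_derivative_of_real)
    ultimately have "(?F has_vector_derivative complex_of_real (g x) * (t *\<^sub>R (\<i> * cis (t * x))) + complex_of_real (g1 x) * cis (t * x)) (at x)"
      by (intro has_vector_derivative_mult)
    then show "(?F has_vector_derivative ?f x) (at x)"
      by (simp add: scaleR_conv_of_real algebra_simps)
    have "isCont g x" "isCont g1 x"
      using cont cont1 by (simp_all add: continuous_on_eq_continuous_at)
    moreover have "isCont (\<lambda>w. cis (t * w)) x"
      by (rule continuous_on_interior[of UNIV]) (auto intro!: continuous_intros)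
    ultimately show "isCont ?f x" by (intro continuous_intros)
  next
    show "set_integrable lborel (einterval (- \<infinity>) \<infinity>) ?f"
      using gi g1i by (simp add: einterval_eq set_integrable_def)
    show "((?F \<circ> real_of_ereal) \<longlongrightarrow> 0) (at_right (- \<infinity>))" "((?F \<circ> real_of_ereal) \<longlongrightarrow> 0) (at_left \<infinity>)"
      using lim by (simp_all add: ereal_tendsto_simps)
  qed simp
  then have "(LINT x|lborel. ?f x) = 0"
    by (simp add: interval_lebesgue_integral_def einterval_eq set_lebesgue_integral_def)
  also have "(LINT x|lborel. ?f x) = fourier_int g1 t + \<i> * complex_of_real t * fourier_int g t"
    unfolding fourier_int_def using gi g1i by simp
  finally show ?thesis by (simp add: add_eq_0_iff)
qed

lemma inv_fourier_of_real:
  "inv_fourier (\<lambda>w. complex_of_real (g w)) t = (1 / (2 * pi)) *\<^sub>R fourier_int g t"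
  by (simp add: inv_fourier_def fourier_int_def cis_conv_exp)

lemma fourier_int_minus: "fourier_int g (- t) = cnj (fourier_int g t)"
  unfolding fourier_int_def by (subst Bochner_Integration.integral_cnj[symmetric]) (simp add: cis_cnj)

lemma time_radius_sq_inv_fourier:
  fixes g g1 :: "real \<Rightarrow> real"
  assumes der: "\<And>x. (g has_real_derivative g1 x) (at x)" and cont1: "continuous_on UNIV g1"
    and dec: "\<And>x. \<bar>g x\<bar> \<le> K / (1 + x\<^sup>2)" and dec1: "\<And>x. \<bar>g1 x\<bar> \<le> K / (1 + x\<^sup>2)"
  shows "time_radius_sq (inv_fourier (\<lambda>w. complex_of_real (g w))) =
    (LINT w|lborel. (g1 w)\<^sup>2) / (LINT w|lborel. (g w)\<^sup>2)"
proof -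
  let ?f = "inv_fourier (\<lambda>w. complex_of_real (g w))"
  have cont: "continuous_on UNIV g"
    using der by (meson DERIV_isCont continuous_at_imp_continuous_on)
  have n: "(cmod (?f t))\<^sup>2 = (1 / (2 * pi))\<^sup>2 * (cmod (fourier_int g t))\<^sup>2" for t
    by (simp add: inv_fourier_of_real power_mult_distrib power_divide)
  have L2: "L2norm_sq ?f = (1 / (2 * pi))\<^sup>2 * (2 * pi * (LINT w|lborel. (g w)\<^sup>2))"
    unfolding L2norm_sq_def n using plancherel_decay(2)[OF cont dec] by simp
  \<comment> \<open>The reflection of \<open>t\<close> shows that the integral equals its own
    negative. The substitution rule requires no integrability, so the centre is 0 even if the
    integral takes its default value.\<close>
  have "(LINT t|lborel. t * (cmod (?f t))\<^sup>2) = \<bar>-1\<bar> *\<^sub>R (LINT t|lborel. (0 + (-1) * t) * (cmod (?f (0 + (-1) * t)))\<^sup>2)"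
    by (rule lborel_integral_real_affine) simp
  also have "\<dots> = - (LINT t|lborel. t * (cmod (?f t))\<^sup>2)"
    by (simp add: n fourier_int_minus)
  finally have tc: "time_centre ?f = 0" by (simp add: time_centre_def)
  have "(LINT t|lborel. t\<^sup>2 * (cmod (?f t))\<^sup>2) = (LINT t|lborel. (1 / (2 * pi))\<^sup>2 * (cmod (fourier_int g1 t))\<^sup>2)"
    by (intro Bochner_Integration.integral_cong refl)
       (simp add: n fourier_int_deriv[OF der cont1 dec dec1] norm_mult power_mult_distrib)
  also have "\<dots> = (1 / (2 * pi))\<^sup>2 * (2 * pi * (LINT w|lborel. (g1 w)\<^sup>2))"
    using plancherel_decay(2)[OF cont1 dec1] by simp
  finally show ?thesis unfolding time_radius_sq_def tc L2 by (simp add: field_simps)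
qed

section \<open>Infinite products of perturbed masks\<close>

lemma abs_exp_minus_one_le:
  fixes s :: real
  assumes "\<bar>s\<bar> \<le> 1 / 2"
  shows "\<bar>exp s - 1\<bar> \<le> 2 * \<bar>s\<bar>"
proof -
  have "exp s \<le> 1 + 2 * \<bar>s\<bar>"
    using exp_bound_lemma[of s] assms by simp
  then show ?thesis using exp_ge_add_one_self[of s] by linarith
qed

lemma cos_le_minus_half:
  assumes "2 * pi / 3 \<le> \<bar>x\<bar>" "\<bar>x\<bar> \<le> 4 * pi / 3"
  shows "cos x \<le> - 1 / 2"
proof -
  have c: "cos y \<le> - 1 / 2" if "2 * pi / 3 \<le> y" "y \<le> pi" for y
    using cos_monotone_0_pi_le[of "2 * pi / 3" y] that by (simp add: cos_120)
  have "cos x = cos \<bar>x\<bar>" by simp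
  also have "\<dots> \<le> - 1 / 2"
  proof (cases "\<bar>x\<bar> \<le> pi")
    case False
    have "cos \<bar>x\<bar> = cos (2 * pi - \<bar>x\<bar>)" by (simp add: cos_diff)
    then show ?thesis using c[of "2 * pi - \<bar>x\<bar>"] False assms by simp
  qed (use c[of "\<bar>x\<bar>"] assms in linarith)
  finally show ?thesis .
qed

text \<open>For a mask \<open>m\<close> close to the Meyer mask, \<open>\<bar>m x\<bar> * refine_weight x \<le> refine_weight (2 * x) / 4\<close>:
  the factor 9 where \<open>cos x \<le> - 1 / 2\<close> makes up for the points \<open>x / 2\<close> at which \<open>m\<close> is not small.
  Iterating this inequality turns the refinement equation into quadratic decay.\<close>

definition refine_weight :: "real \<Rightarrow> real" where
  "refine_weight x = ((1 - cos x) / 2)\<^sup>2 * (if cos x \<le> - 1 / 2 then 9 else 1)"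

lemma refine_weight_le: "refine_weight x \<le> 9"
proof -
  have "((1 - cos x) / 2)\<^sup>2 \<le> 1"
    using abs_cos_le_one[of x] by (simp add: abs_square_le_1 abs_le_iff)
  then show ?thesis by (simp add: refine_weight_def)
qed

lemma refine_weight_nonneg: "0 \<le> refine_weight x"
  by (simp add: refine_weight_def)

text \<open>The identity \<open>(sin x)^4 = 16 * sin (x / 2)^4 * cos (x / 2)^4\<close> with half
  angles eliminated. Its factor \<open>((1 + cos x) / 2)\<^sup>2\<close> is the one that the masks
  will be required to supply near odd multiples of pi, so it can be exchanged for the weight at
  \<open>2 * x\<close>.\<close>

lemma refine_weight_double:
  "refine_weight (2 * x) = 16 * ((1 - cos x) / 2)\<^sup>2 * ((1 + cos x) / 2)\<^sup>2 * (if \<bar>cos x\<bar> \<le> 1 / 2 then 9 else 1)"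
proof -
  have "(cos (2 * x) \<le> - 1 / 2) = ((cos x)\<^sup>2 \<le> (1 / 2)\<^sup>2)"
    unfolding cos_double_cos by (simp add: power_divide) linarith
  also have "\<dots> = (\<bar>cos x\<bar> \<le> 1 / 2)"
    using abs_le_square_iff[of "cos x" "1 / 2"] by simp
  finally have e: "(cos (2 * x) \<le> - 1 / 2) = (\<bar>cos x\<bar> \<le> 1 / 2)" .
  have "((1 - cos (2 * x)) / 2)\<^sup>2 = 16 * ((1 - cos x) / 2)\<^sup>2 * ((1 + cos x) / 2)\<^sup>2"
    unfolding cos_double_cos by (simp add: power2_eq_square field_simps)
  then show ?thesis unfolding refine_weight_def e by simp
qed

lemma refine_weight_ge_5: "5 \<le> refine_weight x" if "cos x \<le> - 1 / 2"
proof -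
  have "(3 / 4)\<^sup>2 \<le> ((1 - cos x) / 2)\<^sup>2"
    using that by (intro power_mono) auto
  then show ?thesis using that by (simp add: refine_weight_def power2_eq_square)
qed

text \<open>\<open>M\<close> is the limit mask and \<open>H\<close> its infinite product, which for
  \<open>\<bar>x\<bar> < 4 * pi / 3\<close> reduces to the single factor \<open>M (x / 2)\<close>
  because the later factors are 1. The mask \<open>m\<close> is a perturbation of size
  \<open>E\<close>, and \<open>m1\<close>, \<open>M1\<close> are derivatives. The bound on
  \<open>E\<close> keeps \<open>m\<close> at least 1 / 2 near 0 and leaves room to absorb
  constants.\<close>

locale mask_perturb =
  fixes M M1 H H1 m m1 :: "real \<Rightarrow> real" and B E :: real
  assumes M_le: "\<bar>M x\<bar> \<le> 1" and M1_le: "\<bar>M1 x\<bar> \<le> B" and B1: "1 \<le> B"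
    and E0: "0 \<le> E" and E_le: "E \<le> 1 / 100"
    and dm: "\<bar>m x - M x\<bar> \<le> E" and dm1: "\<bar>m1 x - M1 x\<bar> \<le> E"
    and m_pi: "cos x \<le> - 1 / 2 \<Longrightarrow> \<bar>m x\<bar> \<le> E * ((1 + cos x) / 2)\<^sup>2"
    and m1_pi: "cos x \<le> - 1 / 2 \<Longrightarrow> \<bar>m1 x\<bar> \<le> E * ((1 + cos x) / 2)\<^sup>2"
    and M_low: "\<bar>x\<bar> < pi / 3 \<Longrightarrow> M x = 1" and M1_low: "\<bar>x\<bar> < pi / 3 \<Longrightarrow> M1 x = 0"
    and H_eq: "\<bar>x\<bar> < 4 * pi / 3 \<Longrightarrow> H x = M (x / 2)"
    and H1_eq: "\<bar>x\<bar> < 4 * pi / 3 \<Longrightarrow> H1 x = M1 (x / 2) / 2"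
    and H_zero: "4 * pi / 3 \<le> \<bar>x\<bar> \<Longrightarrow> H x = 0" and H1_zero: "4 * pi / 3 \<le> \<bar>x\<bar> \<Longrightarrow> H1 x = 0"
    and m_der: "(m has_real_derivative m1 x) (at x)" and m1_cont: "continuous_on UNIV m1"
    and m_0: "m 0 = 1"
begin

section \<open>The logarithm of the infinite product near the origin\<close>

definition phi :: "real \<Rightarrow> real" where "phi x = (\<Prod>j. m (x / 2 ^ Suc j))"

definition logsum :: "real \<Rightarrow> real" where "logsum x = (\<Sum>j. ln (m (x / 2 ^ Suc j)))"

definition logsum1 :: "real \<Rightarrow> real" where
  "logsum1 x = (\<Sum>j. m1 (x / 2 ^ Suc j) / m (x / 2 ^ Suc j) / 2 ^ Suc j)"

text \<open>The iterated halves of these points all lie in \<open>\<bar>y\<bar> < pi / 3\<close>,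
  where \<open>M\<close> is 1, so every factor of the product is at least 1 / 2 and has a logarithm.
  An open convex set is what termwise differentiation and the mean value inequality ask for.\<close>

definition core :: "real set" where "core = {- (2 * pi / 3)<..<2 * pi / 3}"

lemma core_iff: "x \<in> core \<longleftrightarrow> \<bar>x\<bar> < 2 * pi / 3"
  by (auto simp: core_def)

lemma open_core [simp]: "open core" and convex_core [simp]: "convex core" and zero_core [simp]: "0 \<in> core"
  by (auto simp: core_def)

lemma core_half: "x \<in> core \<Longrightarrow> \<bar>x / 2 ^ Suc j\<bar> < pi / 3"
proof -
  assume "x \<in> core"
  have "\<bar>x / 2 ^ Suc j\<bar> = \<bar>x\<bar> / 2 / 2 ^ j" by simp
  also have "\<dots> \<le> \<bar>x\<bar> / 2 / 1" by (rule divide_left_mono) auto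
  finally show ?thesis using \<open>x \<in> core\<close> by (simp add: core_iff)
qed

lemma m_low: "\<bar>y\<bar> < pi / 3 \<Longrightarrow> 1 / 2 \<le> m y" "\<bar>y\<bar> < pi / 3 \<Longrightarrow> \<bar>m1 y\<bar> \<le> E"
  using dm[of y] dm1[of y] M_low[of y] M1_low[of y] E_le by auto

lemma log_deriv_le:
  assumes "x \<in> core"
  shows "\<bar>m1 (x / 2 ^ Suc j) / m (x / 2 ^ Suc j) / 2 ^ Suc j\<bar> \<le> 2 * E * (1 / 2) ^ Suc j"
proof -
  let ?y = "x / 2 ^ Suc j"
  have "\<bar>m1 ?y / m ?y\<bar> = \<bar>m1 ?y\<bar> / m ?y" using m_low(1)[OF core_half[OF assms, of j]] by simp
  also have "\<dots> \<le> E / (1 / 2)"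
    using m_low[OF core_half[OF assms, of j]] E0 by (intro frac_le) auto
  finally have "\<bar>m1 ?y / m ?y\<bar> \<le> 2 * E" by simp
  then have "\<bar>m1 ?y / m ?y\<bar> / 2 ^ Suc j \<le> 2 * E / 2 ^ Suc j" by (intro divide_right_mono) auto
  then show ?thesis unfolding abs_divide by (simp add: power_divide)
qed

lemma half_sums: "(\<lambda>j. 2 * E * (1 / 2) ^ Suc j) sums (2 * E)"
  using sums_mult[OF power_half_series, of "2 * E"] by simp

text \<open>The chain rule supplies \<open>1 / 2 ^ Suc j\<close>, so the differentiated series has a
  geometric majorant from mere boundedness of \<open>m1 / m\<close>.\<close>

lemma logsum_uniform:
  "uniform_limit core (\<lambda>n x. \<Sum>j<n. m1 (x / 2 ^ Suc j) / m (x / 2 ^ Suc j) / 2 ^ Suc j) logsum1 sequentially"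
  unfolding logsum1_def[abs_def]
proof (rule Weierstrass_m_test)
  show "norm (m1 (x / 2 ^ Suc j) / m (x / 2 ^ Suc j) / 2 ^ Suc j) \<le> 2 * E * (1 / 2) ^ Suc j"
    if "x \<in> core" for j x
    unfolding real_norm_def by (rule log_deriv_le[OF that])
  show "summable (\<lambda>j. 2 * E * (1 / 2) ^ Suc j)"
    by (rule sums_summable[OF half_sums])
qed

lemma logsum_deriv:
  assumes "x \<in> core"
  shows "summable (\<lambda>j. ln (m (x / 2 ^ Suc j)))" "(logsum has_real_derivative logsum1 x) (at x)"
proof -
  have d: "((\<lambda>x. ln (m (x / 2 ^ Suc j))) has_real_derivative m1 (x / 2 ^ Suc j) / m (x / 2 ^ Suc j) / 2 ^ Suc j) (at x within core)"
    if "x \<in> core" for x j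
  proof -
    have p: "m (x / 2 ^ Suc j) > 0" using m_low(1)[OF core_half[OF that, of j]] by simp
    have "((\<lambda>x. m (x / 2 ^ Suc j)) has_real_derivative m1 (x / 2 ^ Suc j) * (1 / 2 ^ Suc j)) (at x within core)"
      by (rule DERIV_chain2[OF m_der DERIV_cdivide[OF DERIV_ident]])
    from DERIV_chain2[OF DERIV_ln_divide[OF p] this] show ?thesis by simp
  qed
  have u: "uniformly_convergent_on core (\<lambda>n x. \<Sum>j<n. m1 (x / 2 ^ Suc j) / m (x / 2 ^ Suc j) / 2 ^ Suc j)"
    using logsum_uniform by (auto simp: uniformly_convergent_on_def)
  \<comment> \<open>Convergence is checked only at 0, where each term is \<open>ln 1\<close>; the
    theorem on termwise differentiation carries it to all of \<open>core\<close>.\<close>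
  have s: "summable (\<lambda>j. ln (m (0 / 2 ^ Suc j)))" by (simp add: m_0)
  show "summable (\<lambda>j. ln (m (x / 2 ^ Suc j)))" "(logsum has_real_derivative logsum1 x) (at x)"
    unfolding logsum_def[abs_def] logsum1_def
    using has_field_derivative_series'[OF convex_core d u zero_core s, of x] assms
    by (simp_all only: interior_open open_core)
qed

lemma logsum1_le: "x \<in> core \<Longrightarrow> \<bar>logsum1 x\<bar> \<le> 2 * E"
  unfolding logsum1_def
  using norm_suminf_le[OF _ sums_summable[OF half_sums], of "\<lambda>j. m1 (x / 2 ^ Suc j) / m (x / 2 ^ Suc j) / 2 ^ Suc j"]
    log_deriv_le[of x] sums_unique[OF half_sums] by simp

text \<open>The mean value inequality from 0, where \<open>logsum\<close> vanishes;
  \<open>5 / 2\<close> is an upper bound for \<open>2 * pi / 3\<close>.\<close>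

lemma logsum_le: 
  assumes "x \<in> core" shows "\<bar>logsum x\<bar> \<le> 5 * E"
proof -
  have "norm (logsum x - logsum 0) \<le> 2 * E * norm (x - 0)"
    by (rule field_differentiable_bound[OF convex_core, where f'=logsum1])
       (use logsum_deriv logsum1_le assms in \<open>auto intro: has_field_derivative_at_within\<close>)
  moreover have "logsum 0 = 0" by (simp add: logsum_def m_0)
  moreover have "2 * E * \<bar>x\<bar> \<le> 2 * E * (5 / 2)"
    using assms pi_less_4 pi_approx E0 by (intro mult_left_mono) (auto simp: core_iff)
  ultimately show ?thesis by simp
qed

lemma logsum1_cont: "continuous_on core logsum1"
proof (rule uniform_limit_theorem[OF _ logsum_uniform])
  have c: "continuous_on UNIV m" using m_der by (meson DERIV_isCont continuous_at_imp_continuous_on)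
  have "continuous_on core (\<lambda>x. m1 (x / 2 ^ Suc j) / m (x / 2 ^ Suc j) / 2 ^ Suc j)" for j
    by (intro continuous_intros continuous_on_compose2[OF c] continuous_on_compose2[OF m1_cont])
       (use m_low(1)[OF core_half, of _ j] in force)+
  then show "\<forall>\<^sub>F n in sequentially. continuous_on core (\<lambda>x. \<Sum>j<n. m1 (x / 2 ^ Suc j) / m (x / 2 ^ Suc j) / 2 ^ Suc j)"
    by (intro always_eventually allI continuous_on_sum) auto
qed simp

lemma phi_core:
  assumes "x \<in> core"
  shows "convergent_prod (\<lambda>j. m (x / 2 ^ Suc j))" "phi x = exp (logsum x)"
proof -
  have e: "m (x / 2 ^ Suc j) = exp (ln (m (x / 2 ^ Suc j)))" for j
    using m_low(1)[OF core_half[OF assms, of j]] by simp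
  show "convergent_prod (\<lambda>j. m (x / 2 ^ Suc j))"
    by (subst e, rule convergent_prod_exp[OF logsum_deriv(1)[OF assms]])
  show "phi x = exp (logsum x)"
    unfolding phi_def logsum_def by (subst e, rule prodinf_exp[OF logsum_deriv(1)[OF assms]])
qed

lemma dyadic_exhaust: "\<exists>n. \<bar>x\<bar> < 2 ^ n * a" if "a > 0" for x a :: real
proof -
  obtain n where "\<bar>x\<bar> / a < 2 ^ n" using real_arch_pow[of 2 "\<bar>x\<bar> / a"] by auto
  then show ?thesis using that by (auto simp: field_simps)
qed

section \<open>Convergence and smoothness of the product on the whole line\<close>

lemma prod_convergent: "convergent_prod (\<lambda>j. m (x / 2 ^ Suc j))"
proof -
  obtain n where "\<bar>x\<bar> < 2 ^ n * (2 * pi / 3)" using dyadic_exhaust[of "2 * pi / 3" x] by auto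
  then have "x / 2 ^ n \<in> core" by (simp add: core_iff field_simps)
  from phi_core(1)[OF this] have "convergent_prod (\<lambda>j. m (x / 2 ^ Suc (j + n)))"
    by (simp add: power_add mult_ac)
  then show ?thesis by (rule convergent_prod_offset)
qed

lemma phi_refine: "phi x = m (x / 2) * phi (x / 2)"
proof -
  have "phi x = (\<Prod>k<1. m (x / 2 ^ Suc k)) * (\<Prod>k. m (x / 2 ^ Suc (k + 1)))"
    unfolding phi_def by (rule has_prod_unique[symmetric, OF has_prod_ignore_initial_segment'[OF prod_convergent]])
  then show ?thesis by (simp add: phi_def mult_ac)
qed

text \<open>Each use of the refinement equation doubles the interval on which \<open>phi\<close> is
  continuously differentiable. The induction thereby avoids differentiating an infinite product with
  possible zeros.\<close>

lemma phi_smooth: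
  "(\<forall>x. \<bar>x\<bar> < 2 ^ n * (2 * pi / 3) \<longrightarrow> (phi has_real_derivative deriv phi x) (at x)) \<and>
   continuous_on {x. \<bar>x\<bar> < 2 ^ n * (2 * pi / 3)} (deriv phi)"
proof (induction n)
  case 0
  have "((\<lambda>x. exp (logsum x)) has_real_derivative exp (logsum x) * logsum1 x) (at x)" if "x \<in> core" for x
    using logsum_deriv(2)[OF that] by (auto intro!: derivative_eq_intros)
  then have d: "(phi has_real_derivative exp (logsum x) * logsum1 x) (at x)" if "x \<in> core" for x
    using has_field_derivative_transform_within_open[OF _ open_core that] phi_core(2) that by metis
  have e: "deriv phi x = exp (logsum x) * logsum1 x" if "x \<in> core" for x
    using d[OF that] by (rule DERIV_imp_deriv)
  have c: "continuous_on core logsum"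
    using logsum_deriv(2) by (meson DERIV_isCont continuous_at_imp_continuous_on)
  have "continuous_on core (\<lambda>x. exp (logsum x) * logsum1 x)"
    by (intro continuous_intros c logsum1_cont)
  then have "continuous_on core (deriv phi)" using e by (simp cong: continuous_on_cong)
  moreover have "core = {x. \<bar>x\<bar> < 2 ^ 0 * (2 * pi / 3)}" by (auto simp: core_iff)
  ultimately show ?case using d e by (auto simp: core_iff)
next
  case (Suc n)
  let ?I = "\<lambda>n. {x::real. \<bar>x\<bar> < 2 ^ n * (2 * pi / 3)}"
  have d: "(phi has_real_derivative (m1 (x / 2) * phi (x / 2) + m (x / 2) * deriv phi (x / 2)) / 2) (at x)"
    if "x \<in> ?I (Suc n)" for x
  proof -
    have "x / 2 \<in> ?I n" using that by auto
    then have "((\<lambda>x. m (x / 2) * phi (x / 2)) has_real_derivative (m1 (x / 2) * phi (x / 2) + m (x / 2) * deriv phi (x / 2)) / 2) (at x)"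
      using DERIV_chain2[OF _ DERIV_cdivide[OF DERIV_ident], of phi "deriv phi (x / 2)" x 2 UNIV] Suc
      by (auto intro!: derivative_eq_intros DERIV_chain2[OF m_der] simp: field_simps)
    then show ?thesis by (simp flip: phi_refine)
  qed
  have e: "deriv phi x = (m1 (x / 2) * phi (x / 2) + m (x / 2) * deriv phi (x / 2)) / 2" if "x \<in> ?I (Suc n)" for x
    using d[OF that] by (rule DERIV_imp_deriv)
  have c: "continuous_on UNIV m" "continuous_on (?I n) phi"
    using m_der Suc by (auto intro!: continuous_at_imp_continuous_on DERIV_isCont)
  have "continuous_on (?I (Suc n)) (\<lambda>x. (m1 (x / 2) * phi (x / 2) + m (x / 2) * deriv phi (x / 2)) / 2)"
    by (intro continuous_intros continuous_on_compose2[OF c(1)] continuous_on_compose2[OF m1_cont]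
        continuous_on_compose2[OF c(2)] continuous_on_compose2[OF conjunct2[OF Suc]]) auto
  then have "continuous_on (?I (Suc n)) (deriv phi)" using e by (subst continuous_on_cong[OF refl e])
  moreover have "(phi has_real_derivative deriv phi x) (at x)" if "x \<in> ?I (Suc n)" for x
    using d[OF that] unfolding e[OF that] .
  ultimately show ?case by blast
qed

lemma phi_deriv: "(phi has_real_derivative deriv phi x) (at x)"
  using dyadic_exhaust[of "2 * pi / 3" x] phi_smooth by auto

lemma phi1_cont: "continuous_on UNIV (deriv phi)"
proof -
  have "isCont (deriv phi) x" for x
  proof -
    obtain n where n: "\<bar>x\<bar> < 2 ^ n * (2 * pi / 3)" using dyadic_exhaust[of "2 * pi / 3" x] by auto
    have "open {x::real. \<bar>x\<bar> < 2 ^ n * (2 * pi / 3)}"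
      by (intro open_Collect_less continuous_intros)
    then show ?thesis using phi_smooth[of n] n by (auto simp: continuous_on_eq_continuous_at)
  qed
  then show ?thesis by (simp add: continuous_at_imp_continuous_on)
qed

lemma phi1_refine: "deriv phi x = (m1 (x / 2) * phi (x / 2) + m (x / 2) * deriv phi (x / 2)) / 2"
proof -
  have "((\<lambda>x. m (x / 2) * phi (x / 2)) has_real_derivative (m1 (x / 2) * phi (x / 2) + m (x / 2) * deriv phi (x / 2)) / 2) (at x)"
    by (auto intro!: derivative_eq_intros DERIV_chain2[OF m_der] DERIV_chain2[OF phi_deriv] simp: field_simps)
  then show ?thesis by (intro DERIV_imp_deriv) (simp flip: phi_refine)
qed

lemma phi_core_bounds:
  assumes "\<bar>x\<bar> < 2 * pi / 3"
  shows "\<bar>phi x - 1\<bar> \<le> 10 * E" "\<bar>deriv phi x\<bar> \<le> 3 * E"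
proof -
  have x: "x \<in> core" using assms by (simp add: core_iff)
  show 1: "\<bar>phi x - 1\<bar> \<le> 10 * E"
    using abs_exp_minus_one_le[of "logsum x"] logsum_le[OF x] E_le phi_core(2)[OF x] by simp
  have "((\<lambda>x. exp (logsum x)) has_real_derivative exp (logsum x) * logsum1 x) (at x)"
    using logsum_deriv(2)[OF x] by (auto intro!: derivative_eq_intros)
  then have "(phi has_real_derivative exp (logsum x) * logsum1 x) (at x)"
    using has_field_derivative_transform_within_open[OF _ open_core x] phi_core(2) by metis
  then have "deriv phi x = phi x * logsum1 x"
    using phi_core(2)[OF x] by (simp add: DERIV_imp_deriv)
  moreover have "\<bar>phi x * logsum1 x\<bar> \<le> (3 / 2) * (2 * E)"
    unfolding abs_mult using 1 E_le logsum1_le[OF x] by (intro mult_mono) auto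
  ultimately show "\<bar>deriv phi x\<bar> \<le> 3 * E" by simp
qed

lemma m_le: "\<bar>m x\<bar> \<le> 2" "\<bar>m1 x\<bar> \<le> 2 * B"
  using dm[of x] dm1[of x] M_le[of x] M1_le[of x] E_le B1 by linarith+

text \<open>One refinement step from \<open>core\<close>: \<open>H x\<close> is
  \<open>M (x / 2)\<close> times 1, so the error splits into that of the mask and that of
  \<open>phi (x / 2)\<close> against 1. For the derivative,
  \<open>E * (11 / 10) \<le> 2 * E\<close>, \<open>10 * B * E\<close> and \<open>6 * E\<close> add
  up to at most \<open>18 * B * E\<close>, halved by the chain rule.\<close>

lemma phi_mid_bounds:
  assumes "\<bar>x\<bar> < 4 * pi / 3"
  shows "\<bar>phi x - H x\<bar> \<le> 12 * E" "\<bar>deriv phi x - H1 x\<bar> \<le> 9 * B * E"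
proof -
  let ?y = "x / 2"
  have y: "\<bar>?y\<bar> < 2 * pi / 3" using assms by auto
  note b = phi_core_bounds[OF y]
  have E2: "E * (11 / 10) \<le> 2 * E" using E0 by simp
  have p: "\<bar>phi ?y\<bar> \<le> 11 / 10" using b(1) E_le by linarith
  have "phi x - H x = (m ?y - M ?y) * phi ?y + M ?y * (phi ?y - 1)"
    unfolding phi_refine[of x] H_eq[OF assms] by (simp add: algebra_simps)
  moreover have "\<bar>(m ?y - M ?y) * phi ?y\<bar> \<le> E * (11 / 10)"
    unfolding abs_mult using dm p E0 by (intro mult_mono) auto
  moreover have "\<bar>M ?y * (phi ?y - 1)\<bar> \<le> 1 * (10 * E)"
    unfolding abs_mult using M_le b(1) by (intro mult_mono) auto
  ultimately show "\<bar>phi x - H x\<bar> \<le> 12 * E" using E2 by linarith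
  have "deriv phi x - H1 x = ((m1 ?y - M1 ?y) * phi ?y + M1 ?y * (phi ?y - 1) + m ?y * deriv phi ?y) / 2"
    unfolding phi1_refine[of x] H1_eq[OF assms] by (simp add: algebra_simps)
  moreover have "\<bar>(m1 ?y - M1 ?y) * phi ?y\<bar> \<le> E * (11 / 10)"
    unfolding abs_mult using dm1 p E0 by (intro mult_mono) auto
  moreover have "\<bar>M1 ?y * (phi ?y - 1)\<bar> \<le> B * (10 * E)"
    unfolding abs_mult using M1_le b(1) B1 by (intro mult_mono) auto
  moreover have "\<bar>m ?y * deriv phi ?y\<bar> \<le> 2 * (3 * E)"
    unfolding abs_mult using m_le b(2) by (intro mult_mono) auto
  moreover have "E \<le> B * E" using B1 E0 by (simp add: mult_le_cancel_right1)
  ultimately show "\<bar>deriv phi x - H1 x\<bar> \<le> 9 * B * E" using E2 by (simp add: mult.assoc)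
qed

section \<open>Weighted decay away from the origin\<close>

text \<open>The fourth power of \<open>cos (x / 2)\<close> in \<open>m_pi\<close> and
  \<open>m1_pi\<close> is the one contained in \<open>refine_weight (2 * x)\<close>, and the
  coefficient 16 there exceeds the 9 carried by the weight at \<open>x\<close>. This is where the
  factor \<open>E\<close> is gained.\<close>

lemma weight_step_pi:
  assumes "cos x \<le> - 1 / 2"
  shows "\<bar>m x\<bar> * refine_weight x \<le> E * refine_weight (2 * x)"
    and "\<bar>m1 x\<bar> * refine_weight x \<le> E * refine_weight (2 * x)"
proof -
  let ?s = "((1 - cos x) / 2)\<^sup>2" and ?c = "((1 + cos x) / 2)\<^sup>2"
  have w: "refine_weight x = 9 * ?s" using assms by (simp add: refine_weight_def)
  have w2: "?c * (9 * ?s) \<le> refine_weight (2 * x)"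
  proof -
    have "9 * (?s * ?c) \<le> 16 * (?s * ?c) * (if \<bar>cos x\<bar> \<le> 1 / 2 then 9 else 1)" by simp
    then show ?thesis unfolding refine_weight_double by (simp only: mult_ac)
  qed
  have *: "a * refine_weight x \<le> E * refine_weight (2 * x)" if "a \<le> E * ?c" for a
  proof -
    have "a * refine_weight x \<le> E * ?c * (9 * ?s)"
      unfolding w using that by (intro mult_right_mono) auto
    also have "\<dots> \<le> E * refine_weight (2 * x)"
      using mult_left_mono[OF w2 E0] by (simp add: mult_ac)
    finally show ?thesis .
  qed
  show "\<bar>m x\<bar> * refine_weight x \<le> E * refine_weight (2 * x)"
    "\<bar>m1 x\<bar> * refine_weight x \<le> E * refine_weight (2 * x)"
    using m_pi[OF assms] m1_pi[OF assms] by (auto intro: *)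
qed

text \<open>If \<open>\<bar>cos x\<bar> \<le> 1 / 2\<close>, the point \<open>2 * x\<close> is in
  the zone and the ratio is at least \<open>16 * (1 / 4)\<^sup>2 * 9 = 9\<close>; if
  \<open>cos x > 1 / 2\<close> it is at least \<open>16 * (3 / 4)\<^sup>2 = 9\<close>. In the first
  case the bare sine power would guarantee only the ratio 1.\<close>

lemma weight_double_ge: "8 * refine_weight x \<le> refine_weight (2 * x)" if "- 1 / 2 < cos x"
proof -
  let ?s = "((1 - cos x) / 2)\<^sup>2" and ?c = "((1 + cos x) / 2)\<^sup>2"
  have w: "refine_weight x = ?s" using that by (simp add: refine_weight_def)
  have "1 / 2 \<le> ?c * (if \<bar>cos x\<bar> \<le> 1 / 2 then 9 else 1)"
  proof (cases "\<bar>cos x\<bar> \<le> 1 / 2")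
    case True
    then have "(1 / 4)\<^sup>2 \<le> ?c" by (intro power_mono) auto
    then show ?thesis using True by (simp add: power2_eq_square)
  next
    case False
    then have "(3 / 4)\<^sup>2 \<le> ?c" using that by (intro power_mono) auto
    then show ?thesis using False by (simp add: power2_eq_square)
  qed
  then have "16 * ?s * (1 / 2) \<le> 16 * ?s * (?c * (if \<bar>cos x\<bar> \<le> 1 / 2 then 9 else 1))"
    by (rule mult_left_mono) simp
  then show ?thesis unfolding w refine_weight_double by (simp add: mult_ac)
qed

text \<open>Outside the zone, the crude bound 2 on \<open>m\<close> is paid by the gain 8 of the
  weight; inside it, smallness of \<open>E\<close> suffices. For \<open>m1\<close> no contraction is
  sought, since in the derivative recursion \<open>m1\<close> multiplies \<open>phi\<close>, whose
  decay is controlled separately.\<close>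

lemma weight_step:
  shows "\<bar>m x\<bar> * refine_weight x \<le> refine_weight (2 * x) / 4"
    and "\<bar>m1 x\<bar> * refine_weight x \<le> 2 * B * refine_weight (2 * x)"
proof -
  note nn = refine_weight_nonneg[of "2 * x"] refine_weight_nonneg[of x]
  have "\<bar>m x\<bar> * refine_weight x \<le> refine_weight (2 * x) / 4 \<and> \<bar>m1 x\<bar> * refine_weight x \<le> 2 * B * refine_weight (2 * x)"
  proof (cases "cos x \<le> - 1 / 2")
    case True
    have "E * refine_weight (2 * x) \<le> 1 / 4 * refine_weight (2 * x)" "E * refine_weight (2 * x) \<le> 2 * B * refine_weight (2 * x)"
      using E_le B1 nn by (intro mult_right_mono; simp)+
    then show ?thesis using weight_step_pi[OF True] by simp
  next
    case False
    then have "8 * refine_weight x \<le> refine_weight (2 * x)" by (intro weight_double_ge) simp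
    moreover have "\<bar>m x\<bar> * refine_weight x \<le> 2 * refine_weight x" "\<bar>m1 x\<bar> * refine_weight x \<le> 2 * B * refine_weight x"
      using m_le nn by (auto intro!: mult_right_mono)
    moreover have "2 * B * refine_weight x \<le> 2 * B * refine_weight (2 * x)"
      using B1 calculation nn by (intro mult_left_mono) auto
    ultimately show ?thesis by linarith
  qed
  then show "\<bar>m x\<bar> * refine_weight x \<le> refine_weight (2 * x) / 4"
    "\<bar>m1 x\<bar> * refine_weight x \<le> 2 * B * refine_weight (2 * x)" by auto
qed

text \<open>On this first shell \<open>x / 2\<close> lies in the zone, so \<open>m (x / 2)\<close>
  and \<open>m1 (x / 2)\<close> are small. The bounds 5 and \<open>5 * B\<close> on
  \<open>phi (x / 2)\<close> and its derivative are chosen because the weight at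
  \<open>x / 2\<close> is at least 5 and can replace them. The constant 72 bounds
  \<open>x\<^sup>2\<close>.\<close>

lemma phi_tail_base:
  assumes "4 * pi / 3 \<le> \<bar>x\<bar>" "\<bar>x\<bar> < 8 * pi / 3"
  shows "\<bar>phi x\<bar> * x\<^sup>2 \<le> 72 * E * refine_weight x \<and> \<bar>deriv phi x\<bar> * x\<^sup>2 \<le> 576 * B * E * refine_weight x"
proof -
  let ?y = "x / 2"
  have y: "\<bar>?y\<bar> < 4 * pi / 3" "2 * pi / 3 \<le> \<bar>?y\<bar>" using assms by auto
  have y: "cos ?y \<le> - 1 / 2" "\<bar>?y\<bar> < 4 * pi / 3" using y cos_le_minus_half[of ?y] by auto
  have H: "\<bar>H ?y\<bar> \<le> 1" "\<bar>H1 ?y\<bar> \<le> B / 2" using H_eq[OF y(2)] H1_eq[OF y(2)] M_le[of "?y / 2"] M1_le[of "?y / 2"] by simp_all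
  have BE: "B * E \<le> B * (1 / 100)" using B1 E_le by (intro mult_left_mono) auto
  have p: "\<bar>phi ?y\<bar> \<le> 5" "\<bar>deriv phi ?y\<bar> \<le> 5 * B"
    using phi_mid_bounds(1)[OF y(2)] phi_mid_bounds(2)[OF y(2), unfolded mult.assoc] H E_le BE B1 by linarith+
  note w5 = refine_weight_ge_5[OF y(1)]
  note st = weight_step_pi[OF y(1)]
  have x2: "x\<^sup>2 \<le> 72"
  proof -
    have "\<bar>x\<bar> \<le> 8 * 3.15 / 3" using assms pi_approx by simp
    then have "\<bar>x\<bar>\<^sup>2 \<le> (8 * 3.15 / 3)\<^sup>2" by (intro power_mono) auto
    also have "\<dots> \<le> (72::real)" by (simp add: power2_eq_square)
    finally show ?thesis by simp
  qed
  have 1: "\<bar>m ?y * phi ?y\<bar> \<le> E * refine_weight x" "\<bar>m1 ?y * phi ?y\<bar> \<le> E * refine_weight x"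
  proof -
    have ph: "a * \<bar>phi ?y\<bar> \<le> a * refine_weight ?y" if "0 \<le> a" for a
      using p(1) w5 that by (intro mult_left_mono) auto
    show "\<bar>m ?y * phi ?y\<bar> \<le> E * refine_weight x" "\<bar>m1 ?y * phi ?y\<bar> \<le> E * refine_weight x"
      using st order_trans[OF ph] by (simp_all add: abs_mult)
  qed
  have 2: "\<bar>m ?y * deriv phi ?y\<bar> \<le> B * (E * refine_weight x)"
  proof -
    have "\<bar>m ?y * deriv phi ?y\<bar> \<le> \<bar>m ?y\<bar> * (B * refine_weight ?y)"
      unfolding abs_mult using p(2) w5 B1 by (intro mult_left_mono) (auto intro: order_trans[OF _ mult_left_mono[of 5]])
    also have "\<dots> = B * (\<bar>m ?y\<bar> * refine_weight ?y)" by simp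
    also have "\<dots> \<le> B * (E * refine_weight x)" using st B1 by (intro mult_left_mono) auto
    finally show ?thesis .
  qed
  have "E * refine_weight x \<le> B * (E * refine_weight x)"
    using mult_right_mono[OF B1 mult_nonneg_nonneg[OF E0 refine_weight_nonneg[of x]]] by simp
  then have "\<bar>m1 ?y * phi ?y + m ?y * deriv phi ?y\<bar> \<le> 2 * (B * (E * refine_weight x))"
    using 1 2 abs_triangle_ineq[of "m1 ?y * phi ?y" "m ?y * deriv phi ?y"] by linarith
  then have 3: "\<bar>phi x\<bar> \<le> E * refine_weight x" "\<bar>deriv phi x\<bar> \<le> B * (E * refine_weight x)"
    using 1 unfolding phi_refine[of x] phi1_refine[of x] by simp_all
  have nn: "0 \<le> E * refine_weight x" "0 \<le> B * (E * refine_weight x)"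
    using E0 B1 refine_weight_nonneg[of x] by auto
  have "\<bar>phi x\<bar> * x\<^sup>2 \<le> E * refine_weight x * 72" "\<bar>deriv phi x\<bar> * x\<^sup>2 \<le> B * (E * refine_weight x) * 72"
    by (intro mult_mono 3 x2 nn; simp)+
  then show ?thesis using nn by (simp add: mult_ac)
qed

text \<open>Induction over dyadic shells. The contraction 1 / 4 of the weight exactly offsets
  \<open>x\<^sup>2 = 4 * (x / 2)\<^sup>2\<close>, so the constant 72 is reproduced at every step.
  For the derivative the refinement equation has an additional factor 1 / 2.\<close>

lemma phi_tail_aux:
  "4 * pi / 3 \<le> \<bar>x\<bar> \<Longrightarrow> \<bar>x\<bar> < 2 ^ n * (8 * pi / 3) \<Longrightarrow>
    \<bar>phi x\<bar> * x\<^sup>2 \<le> 72 * E * refine_weight x \<and> \<bar>deriv phi x\<bar> * x\<^sup>2 \<le> 576 * B * E * refine_weight x"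
proof (induction n arbitrary: x)
  case 0
  then show ?case using phi_tail_base by simp
next
  case (Suc n)
  show ?case
  proof (cases "\<bar>x\<bar> < 2 ^ 0 * (8 * pi / 3)")
    case True
    then show ?thesis using phi_tail_base Suc.prems by simp
  next
    case False
    let ?y = "x / 2" and ?w = "refine_weight (x / 2)"
    have IH: "\<bar>phi ?y\<bar> * ?y\<^sup>2 \<le> 72 * E * ?w" "\<bar>deriv phi ?y\<bar> * ?y\<^sup>2 \<le> 576 * B * E * ?w"
      using Suc.IH[of ?y] Suc.prems False by auto
    note st = weight_step[of ?y]
    have "\<bar>phi x\<bar> * x\<^sup>2 = 4 * \<bar>m ?y\<bar> * (\<bar>phi ?y\<bar> * ?y\<^sup>2)"
      unfolding phi_refine[of x] by (simp add: abs_mult power_divide)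
    also have "\<dots> \<le> 4 * \<bar>m ?y\<bar> * (72 * E * ?w)" by (intro mult_left_mono IH) auto
    also have "\<dots> = 4 * (72 * E) * (\<bar>m ?y\<bar> * ?w)" by simp
    also have "\<dots> \<le> 4 * (72 * E) * (refine_weight (2 * ?y) / 4)" using E0 by (intro mult_left_mono st) auto
    finally have 1: "\<bar>phi x\<bar> * x\<^sup>2 \<le> 72 * E * refine_weight x" by simp
    have "\<bar>deriv phi x\<bar> * x\<^sup>2 \<le> (\<bar>m1 ?y\<bar> * \<bar>phi ?y\<bar> + \<bar>m ?y\<bar> * \<bar>deriv phi ?y\<bar>) / 2 * x\<^sup>2"
      unfolding phi1_refine[of x] by (intro mult_right_mono) (auto simp: abs_mult[symmetric])
    also have "\<dots> = 2 * \<bar>m1 ?y\<bar> * (\<bar>phi ?y\<bar> * ?y\<^sup>2) + 2 * \<bar>m ?y\<bar> * (\<bar>deriv phi ?y\<bar> * ?y\<^sup>2)"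
      by (simp add: power_divide field_simps)
    also have "\<dots> \<le> 2 * \<bar>m1 ?y\<bar> * (72 * E * ?w) + 2 * \<bar>m ?y\<bar> * (576 * B * E * ?w)"
      by (intro add_mono mult_left_mono IH) auto
    also have "\<dots> = 144 * E * (\<bar>m1 ?y\<bar> * ?w) + 1152 * B * E * (\<bar>m ?y\<bar> * ?w)" by simp
    \<comment> \<open>The two terms contribute \<open>288 * B * E\<close> each: 576 is the fixed
      point of \<open>K = 288 + K / 2\<close>, which is why the base case is stated with this larger
      constant.\<close>
    also have "\<dots> \<le> 144 * E * (2 * B * refine_weight (2 * ?y)) + 1152 * B * E * (refine_weight (2 * ?y) / 4)"
      using E0 B1 by (intro add_mono mult_left_mono st) auto
    finally have "\<bar>deriv phi x\<bar> * x\<^sup>2 \<le> 576 * B * E * refine_weight x" by simp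
    with 1 show ?thesis ..
  qed
qed

text \<open>For \<open>\<bar>x\<bar> < 4 * pi / 3 < 5\<close> the factor
  \<open>1 + x\<^sup>2\<close> is at most 26. Beyond that \<open>H\<close> vanishes,
  \<open>1 + x\<^sup>2 \<le> 2 * x\<^sup>2\<close> and the weight is at most 9; the largest constant
  is \<open>2 * 576 * 9 = 10368\<close>.\<close>

theorem phi_approx:
  "\<bar>phi x - H x\<bar> \<le> 11000 * B * E / (1 + x\<^sup>2)" "\<bar>deriv phi x - H1 x\<bar> \<le> 11000 * B * E / (1 + x\<^sup>2)"
proof -
  have BE: "E \<le> B * E" "0 \<le> B * E" using B1 E0 by (auto simp: mult_le_cancel_right1)
  have p: "0 < 1 + x\<^sup>2" by (simp add: add_pos_nonneg)
  have "\<bar>phi x - H x\<bar> * (1 + x\<^sup>2) \<le> 11000 * B * E \<and> \<bar>deriv phi x - H1 x\<bar> * (1 + x\<^sup>2) \<le> 11000 * B * E"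
  proof (cases "\<bar>x\<bar> < 4 * pi / 3")
    case True
    then have "\<bar>x\<bar>\<^sup>2 \<le> 5\<^sup>2" using pi_approx by (intro power_mono) auto
    then have x2: "1 + x\<^sup>2 \<le> 26" by simp
    have "\<bar>phi x - H x\<bar> * (1 + x\<^sup>2) \<le> 12 * E * 26" "\<bar>deriv phi x - H1 x\<bar> * (1 + x\<^sup>2) \<le> 9 * B * E * 26"
      using E0 B1 p by (intro mult_mono phi_mid_bounds[OF True] x2; simp)+
    then show ?thesis using BE by (simp add: mult.assoc)
  next
    case False
    obtain n where "\<bar>x\<bar> < 2 ^ n * (8 * pi / 3)" using dyadic_exhaust[of "8 * pi / 3" x] by auto
    then have t: "\<bar>phi x\<bar> * x\<^sup>2 \<le> 72 * E * refine_weight x" "\<bar>deriv phi x\<bar> * x\<^sup>2 \<le> 576 * B * E * refine_weight x"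
      using phi_tail_aux[of x n] False by auto
    have w: "72 * E * refine_weight x \<le> 72 * E * 9" "576 * B * E * refine_weight x \<le> 576 * B * E * 9"
      using E0 B1 by (intro mult_left_mono refine_weight_le; simp)+
    have "1\<^sup>2 \<le> \<bar>x\<bar>\<^sup>2" using False pi_approx by (intro power_mono) auto
    then have x2: "1 + x\<^sup>2 \<le> 2 * x\<^sup>2" by simp
    have "\<bar>a\<bar> * (1 + x\<^sup>2) \<le> 2 * (\<bar>a\<bar> * x\<^sup>2)" for a using mult_left_mono[OF x2, of "\<bar>a\<bar>"] by simp
    from this[of "phi x"] this[of "deriv phi x"] show ?thesis
      using t w BE H_zero[of x] H1_zero[of x] False by (simp add: mult.assoc)
  qed
  then show "\<bar>phi x - H x\<bar> \<le> 11000 * B * E / (1 + x\<^sup>2)" "\<bar>deriv phi x - H1 x\<bar> \<le> 11000 * B * E / (1 + x\<^sup>2)"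
    using p by (simp_all add: pos_le_divide_eq)
qed

end

section \<open>Periodization and orthogonalization\<close>

text \<open>The sum of \<open>1 / (1 + k\<^sup>2)\<close> over all integers, enumerated by
  \<open>int_decode\<close> so that results on series over the naturals, such as termwise
  differentiation, apply.\<close>

definition zsum :: real where "zsum = (\<Sum>j. 1 / (1 + (real_of_int (int_decode j))\<^sup>2))"

lemma abs_int_decode_ge: "real j / 2 \<le> \<bar>real_of_int (int_decode j)\<bar>"
proof -
  have "int j \<le> 2 * \<bar>int_decode j\<bar>"
    by (auto simp: int_decode_def sum_decode_def)
  then have "real_of_int (int j) \<le> real_of_int (2 * \<bar>int_decode j\<bar>)" by (simp only: of_int_le_iff)
  then show ?thesis by simp
qed

lemma summable_int_decode: "summable (\<lambda>j. 1 / (1 + (real_of_int (int_decode j))\<^sup>2))"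
proof (rule summable_comparison_test_ev)
  show "summable (\<lambda>j. 4 * inverse ((real j)\<^sup>2))"
    by (intro summable_mult inverse_power_summable) simp
  have "norm (1 / (1 + (real_of_int (int_decode j))\<^sup>2)) \<le> 4 * inverse ((real j)\<^sup>2)" if "j > 0" for j
  proof -
    have "(real j / 2)\<^sup>2 \<le> \<bar>real_of_int (int_decode j)\<bar>\<^sup>2"
      by (intro power_mono abs_int_decode_ge) simp
    then have "(real j / 2)\<^sup>2 \<le> 1 + (real_of_int (int_decode j))\<^sup>2" by simp
    then have "1 / (1 + (real_of_int (int_decode j))\<^sup>2) \<le> 1 / (real j / 2)\<^sup>2"
      using that by (intro divide_left_mono mult_pos_pos) (auto simp: add_pos_nonneg)
    also have "1 / (real j / 2)\<^sup>2 = 4 * inverse ((real j)\<^sup>2)"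
      by (simp add: power_divide field_simps)
    finally show ?thesis by (subst real_norm_def, subst abs_of_nonneg) (auto simp: add_nonneg_nonneg)
  qed
  then show "\<forall>\<^sub>F j in sequentially. norm (1 / (1 + (real_of_int (int_decode j))\<^sup>2)) \<le> 4 * inverse ((real j)\<^sup>2)"
    by (rule eventually_mono[OF eventually_gt_at_top[of 0]])
qed

lemma zsum_nonneg: "0 \<le> zsum"
  unfolding zsum_def by (intro suminf_nonneg summable_int_decode) (simp add: add_nonneg_nonneg)

text \<open>\<open>Phi_l\<close> is this periodization applied to the square of
  \<open>phi_hat_l\<close>. With unordered summation, periodicity is a mere reindexing of the
  integers.\<close>

definition per :: "(real \<Rightarrow> real) \<Rightarrow> real \<Rightarrow> real" where
  "per f x = (\<Sum>\<^sub>\<infinity>k\<in>(UNIV::int set). f (x + 2 * pi * real_of_int k))"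

lemma shift_bij: "bij_betw (\<lambda>k::int. k + n) UNIV UNIV"
  by (rule bij_betwI[where g="\<lambda>k. k - n"]) auto

lemma per_shift: "per f (x + 2 * pi * real_of_int n) = per f x"
  unfolding per_def
  by (subst infsum_reindex_bij_betw[OF shift_bij[of n], symmetric]) (simp add: algebra_simps)

text \<open>The interval of radius 4 > pi is an open set containing a full period, yet is short
  enough against \<open>2 * pi > 6\<close> that shifting by \<open>a\<close> periods leaves modulus
  at least \<open>\<bar>a\<bar>\<close>. The majorant is thus independent of
  \<open>x\<close>.\<close>

lemma shift_decay:
  fixes a :: int
  assumes "\<bar>x\<bar> < 4"
  shows "1 / (1 + (x + 2 * pi * real_of_int a)\<^sup>2) \<le> 1 / (1 + (real_of_int a)\<^sup>2)"
proof -
  have "\<bar>real_of_int a\<bar> \<le> \<bar>x + 2 * pi * real_of_int a\<bar>"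
  proof (cases "a = 0")
    case False
    then have "1 \<le> \<bar>real_of_int a\<bar>" by linarith
    moreover have "6 * \<bar>real_of_int a\<bar> \<le> 2 * pi * \<bar>real_of_int a\<bar>"
      using pi_gt3 by (intro mult_right_mono) auto
    moreover have "\<bar>2 * pi * real_of_int a\<bar> = 2 * pi * \<bar>real_of_int a\<bar>" by (simp add: abs_mult)
    ultimately show ?thesis using assms by linarith
  qed simp
  then have "\<bar>real_of_int a\<bar>\<^sup>2 \<le> \<bar>x + 2 * pi * real_of_int a\<bar>\<^sup>2" by (rule power_mono) simp
  then show ?thesis by (intro divide_left_mono mult_pos_pos) (auto simp: add_pos_nonneg)
qed

lemma reduce_mod: obtains n :: int where "\<bar>x + 2 * pi * real_of_int n\<bar> < 4"
proof -
  define n where "n = - round (x / (2 * pi))"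
  have "\<bar>real_of_int (round (x / (2 * pi))) - x / (2 * pi)\<bar> \<le> 1 / 2" by (rule of_int_round_abs_le)
  then have "2 * pi * \<bar>real_of_int (round (x / (2 * pi))) - x / (2 * pi)\<bar> \<le> 2 * pi * (1 / 2)"
    by (intro mult_left_mono) auto
  also have "2 * pi * \<bar>real_of_int (round (x / (2 * pi))) - x / (2 * pi)\<bar> =
     \<bar>2 * pi * (real_of_int (round (x / (2 * pi))) - x / (2 * pi))\<bar>" by (simp add: abs_mult)
  also have "2 * pi * (real_of_int (round (x / (2 * pi))) - x / (2 * pi)) = - (x + 2 * pi * real_of_int n)"
    by (simp add: n_def algebra_simps)
  finally have "\<bar>x + 2 * pi * real_of_int n\<bar> < 4" using pi_less_4 by simp
  then show ?thesis by (rule that)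
qed

context
  fixes f :: "real \<Rightarrow> real" and A :: real
  assumes dec: "\<And>x. \<bar>f x\<bar> \<le> A / (1 + x\<^sup>2)"
begin

lemma per_term_le:
  assumes "\<bar>x\<bar> < 4"
  shows "\<bar>f (x + 2 * pi * real_of_int (int_decode j))\<bar> \<le> A * (1 / (1 + (real_of_int (int_decode j))\<^sup>2))"
proof -
  have "A * (1 / (1 + (x + 2 * pi * real_of_int (int_decode j))\<^sup>2)) \<le> A * (1 / (1 + (real_of_int (int_decode j))\<^sup>2))"
    by (rule mult_left_mono[OF shift_decay[OF assms] decay_bounded(2)[OF dec]])
  then show ?thesis using dec[of "x + 2 * pi * real_of_int (int_decode j)"] by simp
qed

lemma per_nat:
  assumes "\<bar>x\<bar> < 4"
  shows "(\<lambda>k. f (x + 2 * pi * real_of_int k)) summable_on UNIV"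
    and "per f x = (\<Sum>j. f (x + 2 * pi * real_of_int (int_decode j)))"
    and "\<bar>per f x\<bar> \<le> A * zsum"
proof -
  have s: "summable (\<lambda>j. A * (1 / (1 + (real_of_int (int_decode j))\<^sup>2)))"
    by (intro summable_mult summable_int_decode)
  have "summable (\<lambda>j. norm (f (x + 2 * pi * real_of_int (int_decode j))))"
    by (rule summable_comparison_test'[OF s]) (use per_term_le[OF assms] in auto)
  then have 1: "(\<lambda>j. f (x + 2 * pi * real_of_int (int_decode j))) summable_on UNIV"
    by (rule norm_summable_imp_summable_on)
  then show 2: "(\<lambda>k. f (x + 2 * pi * real_of_int k)) summable_on UNIV"
    using summable_on_reindex_bij_betw[OF bij_int_decode, of "\<lambda>k. f (x + 2 * pi * real_of_int k)"] by simp
  show 3: "per f x = (\<Sum>j. f (x + 2 * pi * real_of_int (int_decode j)))"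
    unfolding per_def
    by (subst infsum_reindex_bij_betw[OF bij_int_decode, symmetric])
       (rule sums_unique[OF has_sum_imp_sums[OF has_sum_infsum[OF 1]]])
  have "norm (\<Sum>j. f (x + 2 * pi * real_of_int (int_decode j))) \<le> (\<Sum>j. A * (1 / (1 + (real_of_int (int_decode j))\<^sup>2)))"
    by (rule norm_suminf_le[OF _ s]) (use per_term_le[OF assms] in simp)
  also have "\<dots> = A * zsum" unfolding zsum_def by (rule suminf_mult[OF summable_int_decode])
  finally show "\<bar>per f x\<bar> \<le> A * zsum" unfolding 3 by simp
qed

lemma per_summable: "(\<lambda>k. f (x + 2 * pi * real_of_int k)) summable_on UNIV"
proof -
  obtain n where n: "\<bar>x + 2 * pi * real_of_int n\<bar> < 4" by (rule reduce_mod)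
  from per_nat(1)[OF this] have "(\<lambda>k. f (x + 2 * pi * real_of_int (k + n))) summable_on UNIV"
    by (simp add: algebra_simps)
  then show ?thesis
    using summable_on_reindex_bij_betw[OF shift_bij[of n], of "\<lambda>k. f (x + 2 * pi * real_of_int k)"] by simp
qed

lemma per_bound: "\<bar>per f x\<bar> \<le> A * zsum"
proof -
  obtain n where n: "\<bar>x + 2 * pi * real_of_int n\<bar> < 4" by (rule reduce_mod)
  from per_nat(3)[OF this] show ?thesis by (simp add: per_shift)
qed

lemma per_uniform:
  "uniform_limit {-4<..<4} (\<lambda>n x. \<Sum>j<n. f (x + 2 * pi * real_of_int (int_decode j)))
     (\<lambda>x. \<Sum>j. f (x + 2 * pi * real_of_int (int_decode j))) sequentially"
proof (rule Weierstrass_m_test)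
  show "norm (f (x + 2 * pi * real_of_int (int_decode j))) \<le> A * (1 / (1 + (real_of_int (int_decode j))\<^sup>2))"
    if "x \<in> {-4<..<4}" for j x
    unfolding real_norm_def by (rule per_term_le) (use that in auto)
  show "summable (\<lambda>j. A * (1 / (1 + (real_of_int (int_decode j))\<^sup>2)))"
    by (intro summable_mult summable_int_decode)
qed

lemma per_cont:
  assumes "continuous_on UNIV f"
  shows "continuous_on UNIV (per f)"
proof -
  have "continuous_on {-4<..<4} (\<lambda>x. \<Sum>j. f (x + 2 * pi * real_of_int (int_decode j)))"
    by (rule uniform_limit_theorem[OF _ per_uniform])
       (auto intro!: always_eventually continuous_intros continuous_on_compose2[OF assms])
  then have c: "continuous_on {-4<..<4} (per f)"
    by (rule continuous_on_eq) (auto simp: per_nat(2))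
  have "isCont (per f) x" for x
  proof -
    obtain n where n: "\<bar>x + 2 * pi * real_of_int n\<bar> < 4" by (rule reduce_mod)
    then have "isCont (per f) (x + 2 * pi * real_of_int n)"
      using c by (auto simp: continuous_on_eq_continuous_at abs_less_iff)
    then have "isCont (\<lambda>x. per f (x + 2 * pi * real_of_int n)) x"
      by (intro continuous_at_compose[of x "\<lambda>x. x + 2 * pi * real_of_int n" "per f", unfolded o_def] continuous_intros)
    then show ?thesis by (simp add: per_shift)
  qed
  then show ?thesis by (simp add: continuous_at_imp_continuous_on)
qed

end

text \<open>Termwise differentiation on the interval of radius 4, where the differentiated series
  has a uniform majorant, followed by transport to every point by periodicity.\<close>

lemma per_deriv:
  assumes dec: "\<And>x. \<bar>f x\<bar> \<le> A / (1 + x\<^sup>2)" and dec1: "\<And>x. \<bar>f1 x\<bar> \<le> A1 / (1 + x\<^sup>2)"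
    and der: "\<And>x. (f has_real_derivative f1 x) (at x)"
  shows "(per f has_real_derivative per f1 x) (at x)"
proof -
  let ?S = "{-4<..<4::real}"
  have small: "(per f has_real_derivative per f1 x) (at x)" if x: "x \<in> ?S" for x
  proof -
    have d: "((\<lambda>x. f (x + 2 * pi * real_of_int (int_decode j))) has_real_derivative
        f1 (x + 2 * pi * real_of_int (int_decode j))) (at x within ?S)" for x j
      using DERIV_chain2[OF der DERIV_add[OF DERIV_ident DERIV_const], of "2 * pi * real_of_int (int_decode j)" x ?S]
      by simp
    have u: "uniformly_convergent_on ?S (\<lambda>n x. \<Sum>j<n. f1 (x + 2 * pi * real_of_int (int_decode j)))"
      using per_uniform[OF dec1] by (auto simp: uniformly_convergent_on_def)
    have s: "summable (\<lambda>j. f (0 + 2 * pi * real_of_int (int_decode j)))"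
    proof (rule summable_comparison_test'[where N=0])
      show "summable (\<lambda>j. A * (1 / (1 + (real_of_int (int_decode j))\<^sup>2)))"
        by (intro summable_mult summable_int_decode)
      show "norm (f (0 + 2 * pi * real_of_int (int_decode j))) \<le> A * (1 / (1 + (real_of_int (int_decode j))\<^sup>2))" for j
        unfolding real_norm_def by (rule per_term_le[OF dec]) simp
    qed
    have "((\<lambda>x. \<Sum>j. f (x + 2 * pi * real_of_int (int_decode j))) has_real_derivative
        (\<Sum>j. f1 (x + 2 * pi * real_of_int (int_decode j)))) (at x)"
      by (rule has_field_derivative_series'(2)[OF _ d u _ s]) (use x in \<open>auto simp: interior_open\<close>)
    then have "((\<lambda>x. \<Sum>j. f (x + 2 * pi * real_of_int (int_decode j))) has_real_derivative per f1 x) (at x)"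
      using per_nat(2)[OF dec1, of x] x by auto
    then show ?thesis
      by (rule has_field_derivative_transform_within_open[of _ _ _ ?S])
         (use x per_nat(2)[OF dec] in auto)
  qed
  obtain n where n: "\<bar>x + 2 * pi * real_of_int n\<bar> < 4" by (rule reduce_mod)
  then have "(per f has_real_derivative per f1 (x + 2 * pi * real_of_int n)) (at (x + 2 * pi * real_of_int n))"
    by (intro small) auto
  then have "((\<lambda>x. per f (x + 2 * pi * real_of_int n)) has_real_derivative per f1 (x + 2 * pi * real_of_int n)) (at x)"
    by (simp add: DERIV_shift)
  then show ?thesis by (simp add: per_shift)
qed

lemma per_diff:
  assumes "\<And>x. \<bar>f x\<bar> \<le> A / (1 + x\<^sup>2)" "\<And>x. \<bar>h x\<bar> \<le> A' / (1 + x\<^sup>2)"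
  shows "per (\<lambda>x. f x - h x) x = per f x - per h x"
  unfolding per_def
  using infsum_add[OF per_summable[OF assms(1)] summable_on_uminus[THEN iffD2, OF per_summable[OF assms(2)]]]
  by (simp add: infsum_uminus)

lemma decay_mult:
  fixes a b :: "real \<Rightarrow> real"
  assumes a: "\<And>x. \<bar>a x\<bar> \<le> A / (1 + x\<^sup>2)" and b: "\<And>x. \<bar>b x\<bar> \<le> B / (1 + x\<^sup>2)"
  shows "\<bar>a x * b x\<bar> \<le> A * B / (1 + x\<^sup>2)"
proof -
  have "\<bar>a x * b x\<bar> \<le> (A / (1 + x\<^sup>2)) * B"
    unfolding abs_mult by (intro mult_mono a decay_bounded(1)[OF b] order_trans[OF abs_ge_zero a]) auto
  then show ?thesis by simp
qed

lemma decay_add: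
  fixes a b :: "real \<Rightarrow> real"
  assumes "\<And>x. \<bar>a x\<bar> \<le> A / (1 + x\<^sup>2)" "\<And>x. \<bar>b x\<bar> \<le> B / (1 + x\<^sup>2)"
  shows "\<bar>a x + b x\<bar> \<le> (A + B) / (1 + x\<^sup>2)"
  using abs_triangle_ineq[of "a x" "b x"] assms[of x] by (simp add: add_divide_distrib)

text \<open>From \<open>(1 - sqrt p) * (1 + sqrt p) = 1 - p\<close> with second factor at least 1,
  the root is as close to 1 as \<open>p\<close> is; \<open>p \<ge> 1 / 2\<close> keeps all
  reciprocals bounded.\<close>

lemma inverse_sqrt_close:
  fixes p d :: real
  assumes "\<bar>p - 1\<bar> \<le> d" "d \<le> 1 / 2"
  shows "0 < p" "\<bar>1 / sqrt p\<bar> \<le> 2" "\<bar>1 / sqrt p - 1\<bar> \<le> 2 * d" "\<bar>1 / (p * sqrt p)\<bar> \<le> 4"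
proof -
  have p: "1 / 2 \<le> p" using assms by linarith
  then show "0 < p" by simp
  have s: "1 / 2 \<le> sqrt p"
  proof (rule real_le_rsqrt)
    show "(1 / 2)\<^sup>2 \<le> p" using p by (simp add: power_divide)
  qed
  then have i0: "0 < sqrt p" by linarith
  have "1 / sqrt p \<le> 1 / (1 / 2)" using s by (intro divide_left_mono mult_pos_pos i0) auto
  then show i: "\<bar>1 / sqrt p\<bar> \<le> 2" using i0 by simp
  have "(1 - sqrt p) * (1 + sqrt p) = 1 - p" using p by (simp add: algebra_simps)
  then have "\<bar>1 - sqrt p\<bar> * (1 + sqrt p) = \<bar>1 - p\<bar>" using i0 by (metis abs_mult abs_of_pos add_pos_pos zero_less_one)
  moreover have "\<bar>1 - sqrt p\<bar> * 1 \<le> \<bar>1 - sqrt p\<bar> * (1 + sqrt p)" using i0 by (intro mult_left_mono) auto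
  ultimately have "\<bar>1 - sqrt p\<bar> \<le> \<bar>p - 1\<bar>" by (simp only: mult_1_right abs_minus_commute)
  then have r: "\<bar>1 - sqrt p\<bar> \<le> d" using assms by linarith
  have "p \<noteq> 0" using p by linarith
  then have "1 / sqrt p - 1 = (1 - sqrt p) * (1 / sqrt p)" by (simp add: field_simps)
  then have "\<bar>1 / sqrt p - 1\<bar> = \<bar>1 - sqrt p\<bar> * \<bar>1 / sqrt p\<bar>" by (simp only: abs_mult)
  also have "\<dots> \<le> d * 2" using r i by (intro mult_mono) auto
  finally show "\<bar>1 / sqrt p - 1\<bar> \<le> 2 * d" by simp
  have "\<bar>1 / (p * sqrt p)\<bar> = \<bar>1 / p\<bar> * \<bar>1 / sqrt p\<bar>" by (simp add: abs_mult[symmetric])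
  also have "\<dots> \<le> 2 * 2" using p i by (intro mult_mono) (auto simp: abs_of_pos field_simps)
  finally show "\<bar>1 / (p * sqrt p)\<bar> \<le> 4" by simp
qed

section \<open>Orthogonalization as a perturbation\<close>

text \<open>Since the squared shifts of \<open>H\<close> already sum to 1, the periodization of
  \<open>\<phi>\<close> squared is a perturbation of 1; \<open>D_small\<close> keeps it within 1 / 2
  of 1, so dividing by its root is harmless.\<close>

locale orth_perturb =
  fixes H H1 \<phi> \<phi>1 :: "real \<Rightarrow> real" and K D :: real
  assumes H_der: "(H has_real_derivative H1 x) (at x)" and H1_cont: "continuous_on UNIV H1"
    and H_dec: "\<bar>H x\<bar> \<le> K / (1 + x\<^sup>2)" and H1_dec: "\<bar>H1 x\<bar> \<le> K / (1 + x\<^sup>2)"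
    and \<phi>_der: "(\<phi> has_real_derivative \<phi>1 x) (at x)" and \<phi>1_cont: "continuous_on UNIV \<phi>1"
    and close: "\<bar>\<phi> x - H x\<bar> \<le> D / (1 + x\<^sup>2)" and close1: "\<bar>\<phi>1 x - H1 x\<bar> \<le> D / (1 + x\<^sup>2)"
    and H_orth: "per (\<lambda>x. (H x)\<^sup>2) x = 1"
    and K1: "1 \<le> K" and D0: "0 \<le> D" and D_le: "D \<le> 1" and D_small: "6 * K * D * zsum \<le> 1 / 2"
begin

definition \<Phi> where "\<Phi> = per (\<lambda>x. (\<phi> x)\<^sup>2)"
definition \<Phi>1 where "\<Phi>1 = per (\<lambda>x. 2 * \<phi> x * \<phi>1 x)"
definition g where "g x = \<phi> x / sqrt (\<Phi> x)"
definition g1 where "g1 x = \<phi>1 x * (1 / sqrt (\<Phi> x)) - \<phi> x * \<Phi>1 x * (1 / (\<Phi> x * sqrt (\<Phi> x))) / 2"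

lemma \<phi>_dec: "\<bar>\<phi> x\<bar> \<le> 2 * K / (1 + x\<^sup>2)" "\<bar>\<phi>1 x\<bar> \<le> 2 * K / (1 + x\<^sup>2)"
proof -
  have "\<bar>\<phi> x - H x + H x\<bar> \<le> (D + K) / (1 + x\<^sup>2)" "\<bar>\<phi>1 x - H1 x + H1 x\<bar> \<le> (D + K) / (1 + x\<^sup>2)"
    by (intro decay_add close close1 H_dec H1_dec)+
  moreover have "(D + K) / (1 + x\<^sup>2) \<le> 2 * K / (1 + x\<^sup>2)"
    using D_le K1 by (intro divide_right_mono) (auto simp: add_nonneg_nonneg)
  ultimately show "\<bar>\<phi> x\<bar> \<le> 2 * K / (1 + x\<^sup>2)" "\<bar>\<phi>1 x\<bar> \<le> 2 * K / (1 + x\<^sup>2)" by auto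
qed

lemma sq_dec: "\<bar>(\<phi> x)\<^sup>2\<bar> \<le> (2 * K * (2 * K)) / (1 + x\<^sup>2)" "\<bar>(H x)\<^sup>2\<bar> \<le> (K * K) / (1 + x\<^sup>2)"
  unfolding power2_eq_square[of "\<phi> x"] power2_eq_square[of "H x"] by (intro decay_mult \<phi>_dec H_dec)+

lemma sq1_dec: "\<bar>2 * \<phi> x * \<phi>1 x\<bar> \<le> (2 * (2 * K * (2 * K))) / (1 + x\<^sup>2)" "\<bar>2 * H x * H1 x\<bar> \<le> (2 * (K * K)) / (1 + x\<^sup>2)"
proof -
  have "\<bar>\<phi> x * \<phi>1 x\<bar> \<le> (2 * K * (2 * K)) / (1 + x\<^sup>2)" "\<bar>H x * H1 x\<bar> \<le> (K * K) / (1 + x\<^sup>2)"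
    by (intro decay_mult \<phi>_dec H_dec H1_dec)+
  then show "\<bar>2 * \<phi> x * \<phi>1 x\<bar> \<le> (2 * (2 * K * (2 * K))) / (1 + x\<^sup>2)" "\<bar>2 * H x * H1 x\<bar> \<le> (2 * (K * K)) / (1 + x\<^sup>2)"
    by (simp_all add: abs_mult)
qed

lemma \<Phi>_der: "(\<Phi> has_real_derivative \<Phi>1 x) (at x)"
  unfolding \<Phi>_def \<Phi>1_def
  by (rule per_deriv[OF sq_dec(1) sq1_dec(1)]) (auto intro!: derivative_eq_intros \<phi>_der)

lemma \<Phi>1_cont: "continuous_on UNIV \<Phi>1"
  unfolding \<Phi>1_def
  by (rule per_cont[OF sq1_dec(1)]) (intro continuous_intros \<phi>1_cont continuous_at_imp_continuous_on ballI DERIV_isCont[OF \<phi>_der])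

lemma \<Phi>_close: "\<bar>\<Phi> x - 1\<bar> \<le> 6 * K * D * zsum"
proof -
  have "\<bar>(\<phi> x - H x) * (\<phi> x + H x)\<bar> \<le> (D * (2 * K + K)) / (1 + x\<^sup>2)" for x
    by (intro decay_mult decay_add close \<phi>_dec H_dec)
  moreover have "(\<phi> x - H x) * (\<phi> x + H x) = (\<phi> x)\<^sup>2 - (H x)\<^sup>2" for x by (simp add: power2_eq_square algebra_simps)
  ultimately have "\<bar>(\<phi> x)\<^sup>2 - (H x)\<^sup>2\<bar> \<le> (D * (2 * K + K)) / (1 + x\<^sup>2)" for x by simp
  from per_bound[of "\<lambda>x. (\<phi> x)\<^sup>2 - (H x)\<^sup>2", OF this, of x]
  have "\<bar>\<Phi> x - 1\<bar> \<le> D * (2 * K + K) * zsum"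
    unfolding per_diff[OF sq_dec] H_orth \<Phi>_def .
  also have "\<dots> \<le> 6 * K * D * zsum"
    using D0 K1 zsum_nonneg by (intro mult_right_mono) auto
  finally show ?thesis .
qed

text \<open>The periodization of \<open>(H x)\<^sup>2\<close> is constant, so its termwise
  derivative is 0 and \<open>\<Phi>1\<close> can be compared with that instead of being estimated
  alone. This yields a bound proportional to \<open>D\<close>.\<close>

lemma \<Phi>1_close: "\<bar>\<Phi>1 x\<bar> \<le> 6 * K * D * zsum"
proof -
  have "(per (\<lambda>x. (H x)\<^sup>2) has_real_derivative per (\<lambda>x. 2 * H x * H1 x) x) (at x)"
    by (rule per_deriv[OF sq_dec(2) sq1_dec(2)]) (auto intro!: derivative_eq_intros H_der)
  moreover have "per (\<lambda>x. (H x)\<^sup>2) = (\<lambda>x. 1)" using H_orth by auto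
  ultimately have z: "per (\<lambda>x. 2 * H x * H1 x) x = 0"
    using DERIV_unique[OF DERIV_const] by force
  have d: "\<bar>(\<phi> x - H x) * \<phi>1 x + H x * (\<phi>1 x - H1 x)\<bar> \<le> (D * (2 * K) + K * D) / (1 + x\<^sup>2)" for x
    by (intro decay_mult decay_add close close1 \<phi>_dec H_dec)
  have e: "2 * \<phi> x * \<phi>1 x - 2 * H x * H1 x = 2 * ((\<phi> x - H x) * \<phi>1 x + H x * (\<phi>1 x - H1 x))" for x
    by (simp add: algebra_simps)
  have "\<bar>2 * \<phi> x * \<phi>1 x - 2 * H x * H1 x\<bar> \<le> (6 * K * D) / (1 + x\<^sup>2)" for x
  proof -
    have e': "(6 * K * D) / (1 + x\<^sup>2) = 2 * ((D * (2 * K) + K * D) / (1 + x\<^sup>2))" by simp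
    show ?thesis unfolding e abs_mult[of 2] abs_numeral e' by (rule mult_left_mono[OF d]) simp
  qed
  from per_bound[of "\<lambda>x. 2 * \<phi> x * \<phi>1 x - 2 * H x * H1 x", OF this, of x]
  show ?thesis unfolding per_diff[OF sq1_dec] z \<Phi>1_def by simp
qed

lemmas \<Phi>_inv = inverse_sqrt_close[OF \<Phi>_close D_small]

lemma g_der: "(g has_real_derivative g1 x) (at x)"
proof -
  have p: "0 < \<Phi> x" "sqrt (\<Phi> x) * sqrt (\<Phi> x) = \<Phi> x" using \<Phi>_inv(1)[of x] by auto
  have "((\<lambda>x. sqrt (\<Phi> x)) has_real_derivative (inverse (sqrt (\<Phi> x)) / 2) * \<Phi>1 x) (at x)"
    by (rule DERIV_chain2[OF DERIV_real_sqrt[OF p(1)] \<Phi>_der])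
  from DERIV_divide[OF \<phi>_der this]
  have "((\<lambda>x. \<phi> x / sqrt (\<Phi> x)) has_real_derivative
     (\<phi>1 x * sqrt (\<Phi> x) - \<phi> x * (inverse (sqrt (\<Phi> x)) / 2 * \<Phi>1 x)) / (sqrt (\<Phi> x) * sqrt (\<Phi> x))) (at x)"
    using p(1) by simp
  also have "(\<phi>1 x * sqrt (\<Phi> x) - \<phi> x * (inverse (sqrt (\<Phi> x)) / 2 * \<Phi>1 x)) / (sqrt (\<Phi> x) * sqrt (\<Phi> x)) = g1 x"
  proof -
    define s where "s = sqrt (\<Phi> x)"
    have "s \<noteq> 0" "\<Phi> x = s * s" using p by (auto simp: s_def)
    then show ?thesis unfolding g1_def s_def[symmetric] by (simp add: field_simps)
  qed
  finally show ?thesis unfolding g_def[abs_def] .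
qed

lemma g1_cont: "continuous_on UNIV g1"
proof -
  have "\<Phi> x \<noteq> 0" for x using \<Phi>_inv(1)[of x] by simp
  then show ?thesis
    unfolding g1_def[abs_def]
    by (intro continuous_intros \<phi>1_cont \<Phi>1_cont continuous_at_imp_continuous_on ballI DERIV_isCont[OF \<phi>_der] DERIV_isCont[OF \<Phi>_der]) auto
qed

text \<open>With \<open>d = 6 * K * D * zsum\<close>: the term \<open>2 * D\<close> is the closeness
  of \<open>\<phi>\<close> times the bound 2 on the inverse root, \<open>2 * K * d\<close> comes
  from replacing that root by 1, and \<open>4 * K * d\<close> from the derivative of the
  root.\<close>

definition G where "G = 2 * D + 6 * K * (6 * K * D * zsum)"

lemma g_close: "\<bar>g x - H x\<bar> \<le> G / (1 + x\<^sup>2)" "\<bar>g1 x - H1 x\<bar> \<le> G / (1 + x\<^sup>2)"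
proof -
  let ?d = "6 * K * D * zsum" and ?w = "1 + x\<^sup>2"
  let ?s = "1 / sqrt (\<Phi> x)" and ?t = "1 / (\<Phi> x * sqrt (\<Phi> x))"
  have w: "0 < ?w" by (simp add: add_pos_nonneg)
  have d0: "0 \<le> ?d" using K1 D0 zsum_nonneg by simp
  have Dw: "0 \<le> D / ?w" "0 \<le> K / ?w" "0 \<le> 2 * K / ?w" using D0 K1 w by auto
  have b: "\<bar>(\<phi> x - H x) * ?s\<bar> \<le> D / ?w * 2" "\<bar>(\<phi>1 x - H1 x) * ?s\<bar> \<le> D / ?w * 2"
    "\<bar>H x * (?s - 1)\<bar> \<le> K / ?w * (2 * ?d)" "\<bar>H1 x * (?s - 1)\<bar> \<le> K / ?w * (2 * ?d)"
    unfolding abs_mult using \<Phi>_inv[of x] Dw by (intro mult_mono close close1 H_dec H1_dec; simp)+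
  have b5: "\<bar>\<phi> x * \<Phi>1 x * ?t\<bar> \<le> 2 * K / ?w * ?d * 4"
    unfolding abs_mult[of "\<phi> x * \<Phi>1 x"] abs_mult[of "\<phi> x"] using \<Phi>_inv(4)[of x] Dw d0
    by (intro mult_mono \<phi>_dec \<Phi>1_close mult_nonneg_nonneg[OF Dw(3) d0]) auto
  have e: "g x - H x = (\<phi> x - H x) * ?s + H x * (?s - 1)"
    "g1 x - H1 x = ((\<phi>1 x - H1 x) * ?s + H1 x * (?s - 1)) + - (\<phi> x * \<Phi>1 x * ?t / 2)"
    by (simp_all add: g_def g1_def algebra_simps diff_divide_distrib)
  have "\<bar>- (\<phi> x * \<Phi>1 x * ?t / 2)\<bar> \<le> 2 * K / ?w * ?d * 4 / 2"
    unfolding abs_minus_cancel abs_divide abs_numeral by (rule divide_right_mono[OF b5]) simp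
  then have "\<bar>g1 x - H1 x\<bar> \<le> (D / ?w * 2 + K / ?w * (2 * ?d)) + 2 * K / ?w * ?d * 4 / 2"
    unfolding e by (intro order_trans[OF abs_triangle_ineq] add_mono b)
  also have "2 * K / ?w * ?d * 4 / 2 = K / ?w * (4 * ?d)"
  proof -
    have "2 * v * q * 4 / 2 = v * (4 * q)" for v q :: real by simp
    from this[of "K / ?w" ?d] show ?thesis by (simp only: times_divide_eq_right)
  qed
  also have "(D / ?w * 2 + K / ?w * (2 * ?d)) + K / ?w * (4 * ?d) = G / ?w" by (simp add: G_def add_divide_distrib mult_ac)
  finally show "\<bar>g1 x - H1 x\<bar> \<le> G / ?w" .
  have "\<bar>g x - H x\<bar> \<le> D / ?w * 2 + K / ?w * (2 * ?d)"
    unfolding e by (intro order_trans[OF abs_triangle_ineq] add_mono b)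
  also have "\<dots> \<le> (D / ?w * 2 + K / ?w * (2 * ?d)) + K / ?w * (4 * ?d)"
    using Dw d0 by (simp only: le_add_same_cancel1) (intro mult_nonneg_nonneg[OF Dw(2)], simp)
  also have "\<dots> = G / ?w" by (simp add: G_def add_divide_distrib mult_ac)
  finally show "\<bar>g x - H x\<bar> \<le> G / ?w" .
qed

end

lemma integral_square_close:
  fixes a b :: "real \<Rightarrow> real"
  assumes ca: "continuous_on UNIV a" and cb: "continuous_on UNIV b"
    and d: "\<And>x. \<bar>a x - b x\<bar> \<le> G / (1 + x\<^sup>2)" and b: "\<And>x. \<bar>b x\<bar> \<le> K / (1 + x\<^sup>2)"
  shows "\<bar>(LINT x|lborel. (a x)\<^sup>2) - (LINT x|lborel. (b x)\<^sup>2)\<bar> \<le> G * (G + 2 * K) * (LINT x|lborel. 1 / (1 + x\<^sup>2))"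
proof -
  have a: "\<bar>a x\<bar> \<le> (G + K) / (1 + x\<^sup>2)" for x
    using decay_add[of "\<lambda>x. a x - b x" G b K, OF d b] by simp
  have i: "integrable lborel (\<lambda>x. a x * a x)" "integrable lborel (\<lambda>x. b x * b x)"
    by (rule integrable_decay[OF continuous_on_mult[OF ca ca] decay_mult[OF a a]])
       (rule integrable_decay[OF continuous_on_mult[OF cb cb] decay_mult[OF b b]])
  have le: "\<bar>a x * a x - b x * b x\<bar> \<le> G * (G + 2 * K) * (1 / (1 + x\<^sup>2))" for x
  proof -
    have "\<bar>(a x - b x) * (a x + b x)\<bar> \<le> G * ((G + K) + K) / (1 + x\<^sup>2)"
      by (intro decay_mult decay_add d a b)
    moreover have "(a x - b x) * (a x + b x) = a x * a x - b x * b x" by (simp add: algebra_simps)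
    ultimately show ?thesis by (simp add: add.assoc)
  qed
  have "\<bar>LINT x|lborel. (a x * a x - b x * b x)\<bar> \<le> (LINT x|lborel. G * (G + 2 * K) * (1 / (1 + x\<^sup>2)))"
    by (rule Bochner_Integration.integral_abs_bound_integral)
       (use i le integrable_inverse_one_plus_square[of "G * (G + 2 * K)"] in auto)
  then show ?thesis
    unfolding Bochner_Integration.integral_diff[OF i] integral_mult_right_zero by (simp only: power2_eq_square)
qed

lemma quotient_close:
  fixes a b a0 b0 r :: real
  assumes "\<bar>a - a0\<bar> \<le> r" "\<bar>b - b0\<bar> \<le> r" "0 < b0" "0 \<le> a0" "r \<le> b0 / 2"
  shows "\<bar>a / b - a0 / b0\<bar> \<le> r * (2 * (a0 + b0) / b0\<^sup>2)"
proof -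
  have b: "b0 / 2 \<le> b" using assms by linarith
  have r0: "0 \<le> r" using assms(1) by linarith
  have "a / b - a0 / b0 = ((a - a0) * b0 - a0 * (b - b0)) / (b * b0)"
    using b assms(3) by (simp add: field_simps)
  moreover have "\<bar>(a - a0) * b0 - a0 * (b - b0)\<bar> \<le> r * b0 + a0 * r"
  proof -
    have "\<bar>(a - a0) * b0\<bar> \<le> r * b0" "\<bar>a0 * (b - b0)\<bar> \<le> a0 * r"
      using assms by (simp_all add: abs_mult mult_right_mono mult_left_mono)
    then show ?thesis by linarith
  qed
  ultimately have "\<bar>a / b - a0 / b0\<bar> \<le> (r * b0 + a0 * r) / (b * b0)"
    using b assms(3) by (simp add: abs_divide divide_right_mono)
  also have "\<dots> \<le> (r * b0 + a0 * r) / (b0 / 2 * b0)"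
    using b assms r0 by (intro divide_left_mono mult_right_mono add_nonneg_nonneg mult_nonneg_nonneg mult_pos_pos) auto
  also have "\<dots> = r * (2 * (a0 + b0) / b0\<^sup>2)"
    using assms(3) by (simp add: field_simps power2_eq_square)
  finally show ?thesis .
qed

text \<open>The order of quantifiers is the point: \<open>D0\<close> and \<open>L\<close> are fixed
  before the perturbation is given, so the estimate is uniform and can later be applied for each
  l.\<close>

theorem time_radius_sq_orth_stable:
  fixes H H1 :: "real \<Rightarrow> real"
  assumes H_der: "\<And>x. (H has_real_derivative H1 x) (at x)" and H1_cont: "continuous_on UNIV H1"
    and H_dec: "\<And>x. \<bar>H x\<bar> \<le> K / (1 + x\<^sup>2)" and H1_dec: "\<And>x. \<bar>H1 x\<bar> \<le> K / (1 + x\<^sup>2)" and K1: "1 \<le> K"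
    and H_orth: "\<And>x. per (\<lambda>x. (H x)\<^sup>2) x = 1" and H_pos: "0 < (LINT x|lborel. (H x)\<^sup>2)"
  obtains D0 L where "0 < D0" "0 \<le> L"
    "\<And>\<phi> \<phi>1 D. \<lbrakk>\<And>x. (\<phi> has_real_derivative \<phi>1 x) (at x); continuous_on UNIV \<phi>1;
      \<And>x. \<bar>\<phi> x - H x\<bar> \<le> D / (1 + x\<^sup>2); \<And>x. \<bar>\<phi>1 x - H1 x\<bar> \<le> D / (1 + x\<^sup>2); 0 \<le> D; D \<le> D0\<rbrakk> \<Longrightarrow>
      \<bar>time_radius_sq (inv_fourier (\<lambda>x. complex_of_real (\<phi> x / sqrt (per (\<lambda>x. (\<phi> x)\<^sup>2) x)))) -
       time_radius_sq (inv_fourier (\<lambda>x. complex_of_real (H x)))\<bar> \<le> L * D"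
proof -
  define W where "W = (LINT x|lborel. 1 / (1 + x\<^sup>2 :: real))"
  define C where "C = 2 + 36 * K * K * zsum"
  define b0 where "b0 = (LINT x|lborel. (H x)\<^sup>2)"
  define a0 where "a0 = (LINT x|lborel. (H1 x)\<^sup>2)"
  have W0: "0 \<le> W" unfolding W_def by (intro Bochner_Integration.integral_nonneg) (simp add: add_nonneg_nonneg)
  have C2: "2 \<le> C" using K1 zsum_nonneg by (simp add: C_def)
  have a00: "0 \<le> a0" by (simp add: a0_def)
  have b00: "0 < b0" using H_pos by (simp add: b0_def)
  define R where "R = C * (1 + 2 * K) * W"
  have R0: "0 \<le> R" using C2 K1 W0 by (simp add: R_def)
  \<comment> \<open>The three thresholds yield \<open>G \<le> 1\<close>, the hypothesis
    \<open>D_small\<close>, and \<open>R * D \<le> b0 / 2\<close> for the quotient estimate. The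
    summands 1 keep the denominators positive.\<close>
  define D0 where "D0 = min (1 / C) (min (1 / (12 * K * zsum + 1)) (b0 / (2 * R + 1)))"
  have zp: "0 < 12 * K * zsum + 1" using K1 zsum_nonneg by (intro add_nonneg_pos) auto
  have D0: "0 < D0" using C2 zp R0 b00 by (simp add: D0_def)
  let ?L = "R * (2 * (a0 + b0) / b0\<^sup>2)"
  show ?thesis
  proof (rule that[OF D0, of ?L])
    show "0 \<le> ?L" using R0 a00 b00 by simp
    fix \<phi> \<phi>1 D
    assume p: "\<And>x. (\<phi> has_real_derivative \<phi>1 x) (at x)" "continuous_on UNIV \<phi>1"
      "\<And>x. \<bar>\<phi> x - H x\<bar> \<le> D / (1 + x\<^sup>2)" "\<And>x. \<bar>\<phi>1 x - H1 x\<bar> \<le> D / (1 + x\<^sup>2)" "0 \<le> D" "D \<le> D0"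
    have DC: "C * D \<le> 1" using p(6) C2 by (simp add: D0_def field_simps)
    have Dz: "D * (12 * K * zsum + 1) \<le> 1" using p(6) zp by (simp add: D0_def pos_le_divide_eq)
    have DR: "D * (2 * R + 1) \<le> b0" using p(6) R0 by (simp add: D0_def pos_le_divide_eq)
    have D1: "D \<le> 1" using DC mult_right_mono[OF C2 p(5)] p(5) by linarith
    have Ds: "6 * K * D * zsum \<le> 1 / 2" using Dz p(5) by (simp add: algebra_simps)
    interpret orth_perturb H H1 \<phi> \<phi>1 K D
      by unfold_locales (use assms p D1 Ds in auto)
    have GC: "G = C * D" by (simp add: G_def C_def algebra_simps)
    have G1: "0 \<le> G" "G \<le> 1" using DC C2 p(5) by (simp_all add: GC)
    have g_dec: "\<bar>g x\<bar> \<le> (G + K) / (1 + x\<^sup>2)" "\<bar>g1 x\<bar> \<le> (G + K) / (1 + x\<^sup>2)" for x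
      using decay_add[of "\<lambda>x. g x - H x" G H K, OF g_close(1) H_dec] decay_add[of "\<lambda>x. g1 x - H1 x" G H1 K, OF g_close(2) H1_dec]
      by simp_all
    have cont: "continuous_on UNIV g" "continuous_on UNIV H"
      by (auto intro!: continuous_at_imp_continuous_on DERIV_isCont[OF g_der] DERIV_isCont[OF H_der])
    have le: "G * (G + 2 * K) * W \<le> R * D"
    proof -
      have "G * (G + 2 * K) \<le> G * (1 + 2 * K)" using G1 by (intro mult_left_mono) auto
      then have "G * (G + 2 * K) * W \<le> G * (1 + 2 * K) * W" using W0 by (rule mult_right_mono)
      then show ?thesis by (simp add: GC R_def mult_ac)
    qed
    have "\<bar>(LINT x|lborel. (g1 x)\<^sup>2) - a0\<bar> \<le> R * D" "\<bar>(LINT x|lborel. (g x)\<^sup>2) - b0\<bar> \<le> R * D"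
      using integral_square_close[OF g1_cont H1_cont g_close(2) H1_dec] integral_square_close[OF cont g_close(1) H_dec] le
      by (auto simp: a0_def b0_def W_def)
    moreover have "R * D \<le> b0 / 2" using DR p(5) by (simp add: algebra_simps)
    ultimately have "\<bar>(LINT x|lborel. (g1 x)\<^sup>2) / (LINT x|lborel. (g x)\<^sup>2) - a0 / b0\<bar> \<le> R * D * (2 * (a0 + b0) / b0\<^sup>2)"
      using a00 b00 by (intro quotient_close)
    moreover have "time_radius_sq (inv_fourier (\<lambda>x. complex_of_real (g x))) = (LINT x|lborel. (g1 x)\<^sup>2) / (LINT x|lborel. (g x)\<^sup>2)"
      by (rule time_radius_sq_inv_fourier[OF g_der g1_cont g_dec])
    moreover have "time_radius_sq (inv_fourier (\<lambda>x. complex_of_real (H x))) = a0 / b0"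
      unfolding a0_def b0_def by (rule time_radius_sq_inv_fourier[OF H_der H1_cont H_dec H1_dec])
    ultimately show "\<bar>time_radius_sq (inv_fourier (\<lambda>x. complex_of_real (\<phi> x / sqrt (per (\<lambda>x. (\<phi> x)\<^sup>2) x)))) -
       time_radius_sq (inv_fourier (\<lambda>x. complex_of_real (H x)))\<bar> \<le> ?L * D"
      by (simp add: g_def[abs_def] \<Phi>_def mult_ac)
  qed
qed

section \<open>The Meyer mask\<close>

lemma floor_mult_bounds:
  fixes p x :: real
  assumes "0 < p"
  shows "p * real_of_int \<lfloor>x / p\<rfloor> \<le> x" "x < p * real_of_int \<lfloor>x / p\<rfloor> + p"
proof -
  have e: "p * (x / p) = x" using assms by simp
  show "p * real_of_int \<lfloor>x / p\<rfloor> \<le> x"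
    using mult_left_mono[of "real_of_int \<lfloor>x / p\<rfloor>" "x / p" p] assms unfolding e by simp
  have "x / p < real_of_int \<lfloor>x / p\<rfloor> + 1" by linarith
  from mult_strict_left_mono[OF this assms] show "x < p * real_of_int \<lfloor>x / p\<rfloor> + p"
    unfolding e by (simp add: algebra_simps)
qed

locale meyer =
  fixes \<theta> :: "real \<Rightarrow> real" and \<omega>0 :: real
  assumes theta_odd: "\<theta> (- x) = - \<theta> x" and theta_C2: "C2_real \<theta>"
    and theta_const: "x > pi / 3 \<Longrightarrow> \<theta> x = pi / 4"
    and omega0: "pi / 3 \<le> \<omega>0" "\<omega>0 < pi / 2"
begin

lemma theta_der: "(\<theta> has_real_derivative deriv \<theta> x) (at x)"
  and theta1_cont: "continuous_on UNIV (deriv \<theta>)"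
proof -
  obtain f' f'' where f: "\<And>x. (\<theta> has_real_derivative f' x) (at x)" "\<And>x. (f' has_real_derivative f'' x) (at x)"
    using theta_C2 unfolding C2_real_def by blast
  have e: "deriv \<theta> = f'" using f(1) by (auto intro: DERIV_imp_deriv)
  show "(\<theta> has_real_derivative deriv \<theta> x) (at x)" "continuous_on UNIV (deriv \<theta>)"
    unfolding e using f by (auto intro!: continuous_at_imp_continuous_on DERIV_isCont)
qed

text \<open>The hypothesis covers only arguments beyond \<open>pi / 3\<close>; the equations for the
  function and its derivative define closed sets, so the endpoint is included too.\<close>

lemma theta_hi: "\<theta> x = pi / 4" and theta1_hi: "deriv \<theta> x = 0" if "pi / 3 \<le> x"
proof -
  have c: "continuous_on UNIV \<theta>" by (auto intro!: continuous_at_imp_continuous_on DERIV_isCont[OF theta_der])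
  have d: "deriv \<theta> x = 0" if "x > pi / 3" for x
  proof -
    have "((\<lambda>x. pi / 4) has_real_derivative 0) (at x)" by simp
    then have "(\<theta> has_real_derivative 0) (at x)"
      by (rule has_field_derivative_transform_within_open[of _ _ _ "{pi / 3<..}"]) (use that theta_const in auto)
    then show ?thesis by (rule DERIV_imp_deriv)
  qed
  have "closed {x. \<theta> x = pi / 4}" "closed {x. deriv \<theta> x = 0}"
    by (intro closed_Collect_eq continuous_intros c theta1_cont)+
  then have "closure {pi / 3<..} \<subseteq> {x. \<theta> x = pi / 4}" "closure {pi / 3<..} \<subseteq> {x. deriv \<theta> x = 0}"
    using theta_const d by (intro closure_minimal; blast)+
  moreover have "x \<in> closure {pi / 3<..}" using that by simp
  ultimately show "\<theta> x = pi / 4" "deriv \<theta> x = 0" by blast+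
qed

lemma theta_lo: "x \<le> - (pi / 3) \<Longrightarrow> \<theta> x = - (pi / 4)"
  using theta_hi[of "- x"] theta_odd[of x] by simp

definition slope :: real where "slope = pi / (3 * (pi - 2 * \<omega>0))"

lemma slope_pos: "0 < slope" using omega0 by (simp add: slope_def)

lemma slope_mult: "slope * (pi - 2 * \<omega>0) = pi / 3"
  using omega0 by (simp add: slope_def field_simps)

text \<open>The middle branch of \<open>meyer_hat\<close> extended to the whole line. As
  \<open>\<theta>\<close> is constant outside \<open>[-pi / 3, pi / 3]\<close>, the single formula
  also produces the plateau 1 and the value 0, and no case distinction remains.\<close>

definition Q :: "real \<Rightarrow> real" where "Q y = cos (pi / 4 + \<theta> (slope * (y - pi)))"
definition Q1 :: "real \<Rightarrow> real" where
  "Q1 y = - sin (pi / 4 + \<theta> (slope * (y - pi))) * (deriv \<theta> (slope * (y - pi)) * slope)"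

lemma Q_der: "(Q has_real_derivative Q1 y) (at y)"
  unfolding Q_def[abs_def] Q1_def
  by (auto intro!: derivative_eq_intros DERIV_chain2[OF theta_der])

lemma Q1_cont: "continuous_on UNIV Q1"
proof -
  have c: "continuous_on UNIV \<theta>" by (auto intro!: continuous_at_imp_continuous_on DERIV_isCont[OF theta_der])
  show ?thesis unfolding Q1_def[abs_def]
    by (intro continuous_intros continuous_on_compose2[OF c] continuous_on_compose2[OF theta1_cont]) auto
qed

lemma Q_lo: "Q y = 1" and Q1_lo: "Q1 y = 0" if "y \<le> 2 * \<omega>0"
proof -
  have "slope * (y - pi) \<le> slope * - (pi - 2 * \<omega>0)"
    using slope_pos that by (intro mult_left_mono) auto
  then have "slope * (y - pi) \<le> - (pi / 3)" unfolding mult_minus_right slope_mult .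
  then show "Q y = 1" "Q1 y = 0" by (simp_all add: Q_def Q1_def theta_lo)
qed

lemma Q_hi: "Q y = 0" and Q1_hi: "Q1 y = 0" if "2 * pi - 2 * \<omega>0 \<le> y"
proof -
  have "slope * (pi - 2 * \<omega>0) \<le> slope * (y - pi)"
    using slope_pos that by (intro mult_left_mono) auto
  then have "pi / 3 \<le> slope * (y - pi)" using slope_mult by simp
  then show "Q y = 0" "Q1 y = 0" by (simp_all add: Q_def Q1_def theta_hi theta1_hi)
qed

text \<open>Reflection about pi changes the sign of \<open>\<theta>\<close> by oddness, which turns
  the cosine of \<open>pi / 4 + \<theta>\<close> into its sine. This is the orthonormality of the
  Meyer scaling function.\<close>

lemma Q_square: "(Q y)\<^sup>2 + (Q (2 * pi - y))\<^sup>2 = 1"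
proof -
  have "slope * (2 * pi - y - pi) = - (slope * (y - pi))" by (simp add: algebra_simps)
  then have "Q (2 * pi - y) = cos (pi / 4 - \<theta> (slope * (y - pi)))" by (simp add: Q_def theta_odd)
  also have "\<dots> = sin (pi / 4 + \<theta> (slope * (y - pi)))"
    by (simp add: cos_diff sin_add sin_45 cos_45)
  finally show ?thesis unfolding Q_def by simp
qed

abbreviation "H \<equiv> meyer_hat \<theta> \<omega>0"
definition H1 :: "real \<Rightarrow> real" where "H1 x = Q1 x * Q (- x) - Q x * Q1 (- x)"

lemma H_abs: "H x = Q \<bar>x\<bar>"
  using Q_lo[of "\<bar>x\<bar>"] Q_hi[of "\<bar>x\<bar>"] by (auto simp: meyer_hat_def Q_def slope_def)

text \<open>At every point one of the two factors is 1. Unlike \<open>Q \<bar>x\<bar>\<close>, the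
  product is visibly differentiable at 0.\<close>

lemma H_prod: "H x = Q x * Q (- x)"
proof -
  have "Q (- \<bar>x\<bar>) = 1" using omega0 pi_gt_zero by (intro Q_lo) linarith
  then have "H x = Q \<bar>x\<bar> * Q (- \<bar>x\<bar>)" by (simp add: H_abs)
  then show ?thesis by (cases "0 \<le> x") (auto simp: mult.commute)
qed

lemma H_der: "(H has_real_derivative H1 x) (at x)"
proof -
  have "((\<lambda>x. Q x * Q (- x)) has_real_derivative H1 x) (at x)"
    unfolding H1_def
    by (auto intro!: derivative_eq_intros Q_der DERIV_chain2[OF Q_der])
  then show ?thesis by (simp flip: H_prod)
qed

lemma H1_cont: "continuous_on UNIV H1"
proof -
  have c: "continuous_on UNIV Q" by (auto intro!: continuous_at_imp_continuous_on DERIV_isCont[OF Q_der])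
  show ?thesis unfolding H1_def[abs_def]
    by (intro continuous_intros continuous_on_compose2[OF c] continuous_on_compose2[OF Q1_cont]) auto
qed

lemma H_lo: "H x = 1" and H1_lo: "H1 x = 0" if "\<bar>x\<bar> \<le> 2 * \<omega>0"
  using that by (auto simp: H_abs Q_lo H1_def Q1_lo)

lemma H_hi: "H x = 0" and H1_hi: "H1 x = 0" if "4 * pi / 3 \<le> \<bar>x\<bar>"
proof -
  have h: "2 * pi - 2 * \<omega>0 \<le> \<bar>x\<bar>" using that omega0 by linarith
  then show "H x = 0" by (simp add: H_abs Q_hi)
  have "- \<bar>x\<bar> \<le> 2 * \<omega>0" using omega0 pi_gt_zero by linarith
  then show "H1 x = 0" using h by (cases "0 \<le> x") (auto simp: H1_def Q_hi Q1_hi Q1_lo)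
qed

lemma H_le: "\<bar>H x\<bar> \<le> 1" by (simp add: H_abs Q_def)

lemma H1_bounded: "\<exists>B\<ge>1. \<forall>x. \<bar>H1 x\<bar> \<le> B"
proof -
  have "compact (H1 ` {-5..5})"
    by (intro compact_continuous_image continuous_on_subset[OF H1_cont]) auto
  then obtain b where "\<forall>y\<in>H1 ` {-5..5}. norm y \<le> b"
    using compact_imp_bounded[of "H1 ` {-5..5}"] unfolding bounded_iff by blast
  then have b: "\<bar>H1 x\<bar> \<le> b" if "x \<in> {-5..5}" for x using that by auto
  have "\<bar>H1 x\<bar> \<le> max 1 b" for x
  proof (cases "x \<in> {-5..5}")
    case False
    then have "4 * pi / 3 \<le> \<bar>x\<bar>" using pi_approx by auto
    then show ?thesis by (simp add: H1_hi)
  qed (use b[of x] in auto)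
  then show ?thesis by (intro exI[of _ "max 1 b"]) auto
qed

text \<open>Doubled because \<open>M1\<close> is \<open>2 * H1\<close> at a doubled argument:
  \<open>B\<close> then bounds \<open>M1\<close>, and \<open>B / 2\<close> bounds
  \<open>H1\<close>.\<close>

definition B :: real where "B = 2 * (SOME b. 1 \<le> b \<and> (\<forall>x. \<bar>H1 x\<bar> \<le> b))"

lemma B_ge: "2 \<le> B" and H1_le: "\<bar>H1 x\<bar> \<le> B / 2"
proof -
  have "\<exists>b. 1 \<le> b \<and> (\<forall>x. \<bar>H1 x\<bar> \<le> b)" using H1_bounded by auto
  from someI_ex[OF this] show "2 \<le> B" "\<bar>H1 x\<bar> \<le> B / 2" by (auto simp: B_def)
qed

lemma H_dec: "\<bar>H x\<bar> \<le> 26 * B / (1 + x\<^sup>2)" and H1_dec: "\<bar>H1 x\<bar> \<le> 26 * B / (1 + x\<^sup>2)"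
proof -
  have p: "0 < 1 + x\<^sup>2" by (simp add: add_pos_nonneg)
  have "\<bar>H x\<bar> * (1 + x\<^sup>2) \<le> 26 * B \<and> \<bar>H1 x\<bar> * (1 + x\<^sup>2) \<le> 26 * B"
  proof (cases "4 * pi / 3 \<le> \<bar>x\<bar>")
    case True
    then show ?thesis using B_ge by (simp add: H_hi H1_hi)
  next
    case False
    then have "\<bar>x\<bar>\<^sup>2 \<le> 5\<^sup>2" using pi_approx by (intro power_mono) auto
    then have x2: "1 + x\<^sup>2 \<le> 26" by simp
    have "\<bar>H x\<bar> * (1 + x\<^sup>2) \<le> B * 26" "\<bar>H1 x\<bar> * (1 + x\<^sup>2) \<le> B * 26"
      using p B_ge H_le[of x] H1_le[of x] by (intro mult_mono x2; simp)+
    then show ?thesis by (simp add: mult.commute)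
  qed
  then show "\<bar>H x\<bar> \<le> 26 * B / (1 + x\<^sup>2)" "\<bar>H1 x\<bar> \<le> 26 * B / (1 + x\<^sup>2)"
    using p by (simp_all add: pos_le_divide_eq)
qed

text \<open>After reduction to \<open>0 \<le> y < 2 * pi\<close> only the shifts 0 and -1 can meet
  the support, and they give the two squares of \<open>Q_square\<close>.\<close>

lemma H_orth: "per (\<lambda>x. (H x)\<^sup>2) x = 1"
proof -
  define n where "n = - \<lfloor>x / (2 * pi)\<rfloor>"
  define y where "y = x + 2 * pi * real_of_int n"
  have y: "0 \<le> y" "y < 2 * pi"
    using floor_mult_bounds[of "2 * pi" x] by (simp_all add: y_def n_def algebra_simps)
  have "per (\<lambda>x. (H x)\<^sup>2) x = per (\<lambda>x. (H x)\<^sup>2) y" unfolding y_def by (rule per_shift[symmetric])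
  also have "\<dots> = (\<Sum>\<^sub>\<infinity>k\<in>{0, -1}. (H (y + 2 * pi * real_of_int k))\<^sup>2)"
    unfolding per_def
  proof (rule infsum_cong_neutral)
    fix k :: int assume "k \<in> UNIV - {0, - 1}"
    then consider "1 \<le> k" | "k \<le> - 2" by force
    then have "4 * pi / 3 \<le> \<bar>y + 2 * pi * real_of_int k\<bar>"
    proof cases
      case 1
      then have "2 * pi * 1 \<le> 2 * pi * real_of_int k" by (intro mult_left_mono) auto
      then show ?thesis using y pi_gt_zero by linarith
    next
      case 2
      then have "2 * pi * real_of_int k \<le> 2 * pi * (- 2)" by (intro mult_left_mono) auto
      then show ?thesis using y pi_gt_zero by linarith
    qed
    then show "(H (y + 2 * pi * real_of_int k))\<^sup>2 = 0" by (simp add: H_hi)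
  qed auto
  also have "\<dots> = (H y)\<^sup>2 + (H (y - 2 * pi))\<^sup>2" by simp
  also have "\<dots> = 1" using y Q_square[of y] by (simp add: H_abs)
  finally show ?thesis .
qed

lemma H_pos: "0 < (LINT x|lborel. (H x)\<^sup>2)"
proof -
  have c: "continuous_on UNIV H" by (auto intro!: continuous_at_imp_continuous_on DERIV_isCont[OF H_der])
  have i: "integrable lborel (\<lambda>x. H x * H x)"
    by (rule integrable_decay[OF continuous_on_mult[OF c c] decay_mult[OF H_dec H_dec]])
  have "(LINT x|lborel. indicator {0..1::real} x) \<le> (LINT x|lborel. H x * H x)"
  proof (rule Bochner_Integration.integral_mono)
    show "indicator {0..1} x \<le> H x * H x" for x
      using H_lo[of x] omega0 pi_gt3 by (auto simp: indicator_def)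
  qed (use i in auto)
  then show ?thesis by (simp add: power2_eq_square)
qed

abbreviation "M \<equiv> meyer_mask \<theta> \<omega>0"
definition res :: "real \<Rightarrow> real" where "res x = x - 2 * pi * real_of_int \<lfloor>(x + pi) / (2 * pi)\<rfloor>"
definition M1 :: "real \<Rightarrow> real" where "M1 x = 2 * H1 (2 * res x)"

lemma res_bounds: "- pi \<le> res x" "res x < pi"
proof -
  show "- pi \<le> res x" "res x < pi"
    using floor_mult_bounds[of "2 * pi" "x + pi"] by (simp_all add: res_def algebra_simps)
qed

lemma M_res: "M x = H (2 * res x)"
  by (simp add: meyer_mask_def res_def)

lemma res_shift: "res (x + 2 * pi * real_of_int n) = res x"
proof -
  have "(x + 2 * pi * real_of_int n + pi) / (2 * pi) = (x + pi) / (2 * pi) + real_of_int n"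
    by (simp add: field_simps)
  then show ?thesis unfolding res_def by (simp add: algebra_simps)
qed

text \<open>Any period index \<open>k\<close> within the stated range may be used, not only the
  nearest: for another one both sides vanish. This eliminates the floor function on an open
  interval, so that \<open>M\<close> is seen to be differentiable also at odd multiples of
  pi.\<close>

lemma M_local: "M x = H (2 * (x - 2 * pi * real_of_int k))" and M1_local: "M1 x = 2 * H1 (2 * (x - 2 * pi * real_of_int k))"
  if "\<bar>x - 2 * pi * real_of_int k\<bar> < 4 * pi / 3"
proof -
  define n where "n = \<lfloor>(x + pi) / (2 * pi)\<rfloor>"
  define y where "y = x - 2 * pi * real_of_int k"
  have yr: "y = res x + 2 * pi * real_of_int (n - k)" by (simp add: y_def res_def n_def algebra_simps)
  note b = res_bounds[of x]
  have "H (2 * res x) = H (2 * y) \<and> H1 (2 * res x) = H1 (2 * y)"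
  proof (cases "n = k")
    case False
    then consider "1 \<le> n - k" | "n - k \<le> - 1" by force
    then have "4 * pi / 3 \<le> \<bar>2 * res x\<bar> \<and> 4 * pi / 3 \<le> \<bar>2 * y\<bar>"
    proof cases
      case 1
      then have "2 * pi * 1 \<le> 2 * pi * real_of_int (n - k)" by (intro mult_left_mono) auto
      then show ?thesis using that b yr unfolding y_def[symmetric] by linarith
    next
      case 2
      then have "2 * pi * real_of_int (n - k) \<le> 2 * pi * (- 1)" by (intro mult_left_mono) auto
      then show ?thesis using that b yr unfolding y_def[symmetric] by linarith
    qed
    then show ?thesis by (simp add: H_hi H1_hi)
  qed (simp add: yr)
  then show "M x = H (2 * (x - 2 * pi * real_of_int k))" "M1 x = 2 * H1 (2 * (x - 2 * pi * real_of_int k))"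
    by (simp_all add: M_res M1_def y_def)
qed

lemma M_der: "(M has_real_derivative M1 x) (at x)"
proof -
  define k where "k = \<lfloor>(x + pi) / (2 * pi)\<rfloor>"
  let ?S = "{x. \<bar>x - 2 * pi * real_of_int k\<bar> < 4 * pi / 3}"
  have o: "open ?S" by (intro open_Collect_less continuous_intros)
  have "\<bar>x - 2 * pi * real_of_int k\<bar> \<le> pi" using res_bounds[of x] unfolding res_def k_def by linarith
  then have "\<bar>x - 2 * pi * real_of_int k\<bar> < 4 * pi / 3" using pi_gt_zero by linarith
  then have x: "x \<in> ?S" by simp
  have "((\<lambda>x. H (2 * (x - 2 * pi * real_of_int k))) has_real_derivative H1 (2 * (x - 2 * pi * real_of_int k)) * 2) (at x)"
    by (rule DERIV_chain2[OF H_der]) (auto intro!: derivative_eq_intros)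
  then have "((\<lambda>x. H (2 * (x - 2 * pi * real_of_int k))) has_real_derivative M1 x) (at x)"
    using M1_local[of x k] x by (simp add: mult.commute)
  then show ?thesis
    by (rule has_field_derivative_transform_within_open[OF _ o x]) (use M_local in auto)
qed

lemma res_cos: "cos (res x) = cos x" "sin (res x) = sin x"
proof -
  have "cos (res x + 2 * pi * real_of_int n) = cos (res x)" "sin (res x + 2 * pi * real_of_int n) = sin (res x)" for n
    using cos_int_2pin[of n] sin_int_2pin[of n] by (simp_all add: cos_add sin_add)
  from this[of "\<lfloor>(x + pi) / (2 * pi)\<rfloor>"] show "cos (res x) = cos x" "sin (res x) = sin x"
    by (simp_all add: res_def)
qed

lemma M_pi: "M x = 0" and M1_pi: "M1 x = 0" if "cos x \<le> - 1 / 2"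
proof -
  have "2 * pi / 3 \<le> \<bar>res x\<bar>"
  proof (rule ccontr)
    assume "\<not> 2 * pi / 3 \<le> \<bar>res x\<bar>"
    then have "cos (2 * pi / 3) < cos \<bar>res x\<bar>" by (intro cos_monotone_0_pi) auto
    then show False using that res_cos[of x] by (simp add: cos_120)
  qed
  then have "4 * pi / 3 \<le> \<bar>2 * res x\<bar>" by auto
  then show "M x = 0" "M1 x = 0" by (simp_all add: M_res M1_def H_hi H1_hi)
qed

lemma M_le: "\<bar>M x\<bar> \<le> 1" and M1_le: "\<bar>M1 x\<bar> \<le> B"
  using H_le[of "2 * res x"] H1_le[of "2 * res x"] by (simp_all add: M_res M1_def)

lemma M_low: "M x = 1" and M1_low: "M1 x = 0" if "\<bar>x\<bar> < pi / 3"
proof -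
  have "\<bar>x - 2 * pi * real_of_int 0\<bar> < 4 * pi / 3" using that by simp
  moreover have "\<bar>2 * x\<bar> \<le> 2 * \<omega>0" using that omega0 by auto
  ultimately show "M x = 1" "M1 x = 0" using M_local[of x 0] M1_local[of x 0] by (simp_all add: H_lo H1_lo)
qed

lemma H_eq_M: "H x = M (x / 2)" and H1_eq_M1: "H1 x = M1 (x / 2) / 2" if "\<bar>x\<bar> < 4 * pi / 3"
proof -
  have "\<bar>x / 2 - 2 * pi * real_of_int 0\<bar> < 4 * pi / 3" using that by simp
  then show "H x = M (x / 2)" "H1 x = M1 (x / 2) / 2" using M_local[of "x / 2" 0] M1_local[of "x / 2" 0] by simp_all
qed

end

section \<open>Summation methods applied to the Meyer mask\<close>

lemma cos_sin_int_shift: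
  "cos (real k * (x + 2 * pi * real_of_int n)) = cos (real k * x)"
  "sin (real k * (x + 2 * pi * real_of_int n)) = sin (real k * x)"
proof -
  have e: "real k * (x + 2 * pi * real_of_int n) = real k * x + 2 * pi * real_of_int (int k * n)"
    by (simp add: algebra_simps)
  show "cos (real k * (x + 2 * pi * real_of_int n)) = cos (real k * x)"
    "sin (real k * (x + 2 * pi * real_of_int n)) = sin (real k * x)"
    unfolding e cos_add sin_add cos_int_2pin sin_int_2pin by simp_all
qed

lemma summ_method_shift: "summ_method lam n f (x + 2 * pi * real_of_int j) = summ_method lam n f x"
  by (simp add: summ_method_def cos_sin_int_shift)

text \<open>Integration by parts over a period. The boundary term of the cosine cancels by
  periodicity, that of the sine because \<open>sin (k * pi)\<close> is 0. The case
  \<open>k = 0\<close> shows that the derivative has no constant term.\<close>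

lemma four_deriv:
  assumes der: "\<And>x. (f has_real_derivative f1 x) (at x)" and per: "f (- pi) = f pi"
  shows "four_a f1 k = real k * four_b f k" "four_b f1 k = - real k * four_a f k"
proof -
  have c: "continuous_on A f" for A by (auto intro!: continuous_at_imp_continuous_on DERIV_isCont[OF der])
  have "((\<lambda>t. f1 t * cos (real k * t) - real k * (f t * sin (real k * t))) has_integral
     (f pi * cos (real k * pi) - f (- pi) * cos (real k * (- pi)))) {-pi..pi}"
    by (rule fundamental_theorem_of_calculus)
       (auto intro!: derivative_eq_intros has_field_derivative_at_within[OF der]
         simp: has_real_derivative_iff_has_vector_derivative[symmetric])
  then have 1: "((\<lambda>t. f1 t * cos (real k * t) - real k * (f t * sin (real k * t))) has_integral 0) {-pi..pi}"
    using per by simp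
  have "((\<lambda>t. f1 t * sin (real k * t) + real k * (f t * cos (real k * t))) has_integral
     (f pi * sin (real k * pi) - f (- pi) * sin (real k * (- pi)))) {-pi..pi}"
    by (rule fundamental_theorem_of_calculus)
       (auto intro!: derivative_eq_intros has_field_derivative_at_within[OF der]
         simp: has_real_derivative_iff_has_vector_derivative[symmetric])
  then have 2: "((\<lambda>t. f1 t * sin (real k * t) + real k * (f t * cos (real k * t))) has_integral 0) {-pi..pi}"
    by simp
  have s: "((\<lambda>t. real k * (f t * sin (real k * t))) has_integral real k * integral {-pi..pi} (\<lambda>t. f t * sin (real k * t))) {-pi..pi}"
    and co: "((\<lambda>t. real k * (f t * cos (real k * t))) has_integral real k * integral {-pi..pi} (\<lambda>t. f t * cos (real k * t))) {-pi..pi}"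
    by (intro has_integral_mult_right integrable_integral integrable_continuous_real continuous_intros c)+
  from has_integral_add[OF 1 s] have "integral {-pi..pi} (\<lambda>t. f1 t * cos (real k * t)) = real k * integral {-pi..pi} (\<lambda>t. f t * sin (real k * t))"
    by (intro integral_unique) simp
  then show "four_a f1 k = real k * four_b f k" by (simp add: four_a_def four_b_def)
  from has_integral_diff[OF 2 co] have "integral {-pi..pi} (\<lambda>t. f1 t * sin (real k * t)) = - (real k * integral {-pi..pi} (\<lambda>t. f t * cos (real k * t)))"
    by (intro integral_unique) simp
  then show "four_b f1 k = - real k * four_a f k" by (simp add: four_a_def four_b_def)
qed

text \<open>The multipliers depend only on the frequency, so summation commutes with
  differentiation. This lets \<open>gamma_l\<close> control the derivative of
  \<open>u_l\<close>.\<close>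

lemma summ_method_deriv:
  assumes der: "\<And>x. (f has_real_derivative f1 x) (at x)" and per: "f (- pi) = f pi"
  shows "(summ_method lam n f has_real_derivative summ_method lam n f1 x) (at x)"
proof -
  have "((\<lambda>x. four_a f 0 / 2 + (\<Sum>k=1..n. lam n k * (four_a f k * cos (real k * x) + four_b f k * sin (real k * x)))) has_real_derivative
    0 + (\<Sum>k=1..n. lam n k * (four_a f k * (- sin (real k * x) * real k) + four_b f k * (cos (real k * x) * real k)))) (at x)"
    by (intro DERIV_add DERIV_const DERIV_sum DERIV_cmult DERIV_chain2[OF DERIV_cos] DERIV_chain2[OF DERIV_sin] DERIV_cmult_Id)
  also have "0 + (\<Sum>k=1..n. lam n k * (four_a f k * (- sin (real k * x) * real k) + four_b f k * (cos (real k * x) * real k)))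
     = summ_method lam n f1 x"
    unfolding summ_method_def four_deriv[OF der per] by (simp add: algebra_simps)
  finally show ?thesis unfolding summ_method_def[abs_def] .
qed

lemma summ_method_cont: "continuous_on A (summ_method lam n f)"
  unfolding summ_method_def[abs_def] by (intro continuous_intros)

text \<open>Boundedness has to be supplied because a real supremum is an upper bound only for a set
  that is bounded above.\<close>

lemma Cnorm_upper:
  assumes "\<And>x. x \<in> {-pi..pi} \<Longrightarrow> \<bar>f x\<bar> \<le> b" "x \<in> {-pi..pi}"
  shows "\<bar>f x\<bar> \<le> Cnorm f"
  unfolding Cnorm_def by (rule cSUP_upper[OF assms(2)], rule bdd_aboveI2, rule assms(1))

lemma Cnorm_nonneg:
  assumes "\<And>x. x \<in> {-pi..pi} \<Longrightarrow> \<bar>f x\<bar> \<le> b"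
  shows "0 \<le> Cnorm f"
proof -
  have "\<bar>f 0\<bar> \<le> Cnorm f" by (rule Cnorm_upper[OF assms]) auto
  then show ?thesis by linarith
qed

lemma continuous_bounded_Icc:
  fixes f :: "real \<Rightarrow> real"
  assumes "continuous_on {a..b} f"
  obtains c where "\<And>x. x \<in> {a..b} \<Longrightarrow> \<bar>f x\<bar> \<le> c"
proof -
  have "bounded (f ` {a..b})"
    by (intro compact_imp_bounded compact_continuous_image assms) auto
  then obtain c where "\<forall>y\<in>f ` {a..b}. norm y \<le> c" unfolding bounded_iff by blast
  then show ?thesis by (intro that[of c]) auto
qed

text \<open>This is \<open>(cos (x / 2))\<^sup>2\<close>, written so that it is manifestly periodic
  with period \<open>2 * pi\<close>.\<close>

definition hc :: "real \<Rightarrow> real" where "hc x = (1 + cos x) / 2"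

lemma hc_bounds: "0 \<le> hc x" "hc x \<le> 1"
proof -
  have "0 \<le> 1 + cos x" "cos x \<le> 1" using cos_ge_minus_one[of x] cos_le_one[of x] by linarith+
  then show "0 \<le> hc x" "hc x \<le> 1" unfolding hc_def by simp_all
qed

lemma hc_cos_half: "cos (x / 2) ^ (2 * l) = hc x ^ l"
proof -
  have "cos x = 2 * (cos (x / 2))\<^sup>2 - 1" using cos_double_cos[of "x / 2"] by simp
  then have "(cos (x / 2))\<^sup>2 = hc x" by (simp add: hc_def)
  then show ?thesis by (simp add: power_mult)
qed

lemma hc_power_der: "((\<lambda>x. hc x ^ l) has_real_derivative real l * hc x ^ (l - 1) * (- sin x / 2)) (at x)"
  unfolding hc_def by (auto intro!: derivative_eq_intros)

context meyer
begin

abbreviation "Mq \<equiv> meyer_mask_l \<theta> \<omega>0"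

lemma Mq_eq: "Mq l x = M x / hc x ^ l"
  by (simp add: meyer_mask_l_def hc_cos_half)

text \<open>The quotient rule for \<open>M / hc ^ l\<close>. The explicit zero covers a
  neighbourhood of each odd multiple of pi, where \<open>hc\<close> vanishes and the quotient has no
  meaning.\<close>

definition DL :: "nat \<Rightarrow> real \<Rightarrow> real" where
  "DL l x = (if cos x \<le> - 1 / 2 then 0
     else (M1 x * hc x ^ l - M x * (real l * hc x ^ (l - 1) * (- sin x / 2))) / (hc x ^ l * hc x ^ l))"

lemma Mq_pi: "cos x \<le> - 1 / 2 \<Longrightarrow> Mq l x = 0" "cos x \<le> - 1 / 2 \<Longrightarrow> DL l x = 0"
  by (auto simp: Mq_eq M_pi DL_def)

lemma hc_ge: "\<not> cos x \<le> - 1 / 2 \<Longrightarrow> 1 / 4 \<le> hc x"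
  unfolding hc_def by simp

lemma Mq_der: "(Mq l has_real_derivative DL l x) (at x)"
proof (cases "cos x < - 1 / 2")
  case True
  have o: "open {x::real. cos x < - 1 / 2}" by (intro open_Collect_less continuous_intros)
  have "((\<lambda>x. 0) has_real_derivative DL l x) (at x)" using True by (simp add: Mq_pi)
  then show ?thesis
    by (rule has_field_derivative_transform_within_open[OF _ o]) (use True in \<open>auto simp: Mq_pi\<close>)
next
  case False
  then have "hc x ^ l \<noteq> 0" by (auto simp: hc_def)
  from DERIV_divide[OF M_der hc_power_der this]
  have d: "((\<lambda>x. M x / hc x ^ l) has_real_derivative
     (M1 x * hc x ^ l - M x * (real l * hc x ^ (l - 1) * (- sin x / 2))) / (hc x ^ l * hc x ^ l)) (at x)" .
  \<comment> \<open>At the boundary \<open>cos x = - 1 / 2\<close> both \<open>M\<close> and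
    \<open>M1\<close> vanish, so the two branches agree.\<close>
  have "(M1 x * hc x ^ l - M x * (real l * hc x ^ (l - 1) * (- sin x / 2))) / (hc x ^ l * hc x ^ l) = DL l x"
    by (cases "cos x \<le> - 1 / 2") (simp_all add: DL_def M_pi M1_pi)
  with d show ?thesis by (simp add: Mq_eq[abs_def])
qed

lemma Mq_deriv: "deriv (Mq l) = DL l"
  using Mq_der by (auto intro: DERIV_imp_deriv)

lemma Mq_M: "hc x ^ l * Mq l x = M x"
proof (cases "cos x \<le> - 1 / 2")
  case False
  then have "hc x ^ l \<noteq> 0" using hc_ge[of x] by auto
  then show ?thesis by (simp add: Mq_eq)
qed (simp add: Mq_pi M_pi)

text \<open>The product rule for \<open>hc ^ l * Mq l = M\<close>, in the same shape as the
  derivative of the perturbed mask, so that the two can be subtracted term by term.\<close>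

lemma DL_M1: "real l * hc x ^ (l - 1) * (- sin x / 2) * Mq l x + hc x ^ l * DL l x = M1 x"
proof (cases "cos x \<le> - 1 / 2")
  case False
  define h where "h = hc x ^ l"
  have h: "h \<noteq> 0" using False hc_ge[of x] by (auto simp: h_def)
  show ?thesis unfolding Mq_eq DL_def h_def[symmetric] using False h by (simp add: field_simps)
qed (simp add: Mq_pi M1_pi)

text \<open>Differentiation costs one power of \<open>hc\<close>; as \<open>hc \<ge> 1 / 4\<close>
  wherever \<open>M\<close> is nonzero, the price is a factor 4.\<close>

lemma Mq_small: "\<bar>hc x ^ (l - 1) * Mq l x\<bar> \<le> 4" if "1 \<le> l"
proof (cases "cos x \<le> - 1 / 2")
  case False
  note h = hc_ge[OF False]
  have e: "hc x * (hc x ^ (l - 1) * Mq l x) = M x"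
    using Mq_M[of x l] that by (cases l) (simp_all add: mult.assoc)
  have "1 / 4 * \<bar>hc x ^ (l - 1) * Mq l x\<bar> \<le> hc x * \<bar>hc x ^ (l - 1) * Mq l x\<bar>"
    by (intro mult_right_mono h) simp
  also have "\<dots> = \<bar>M x\<bar>" using e h by (metis abs_mult abs_of_nonneg hc_bounds(1))
  finally show ?thesis using M_le[of x] by linarith
qed (simp add: Mq_pi)

lemma sin_half_le: "\<bar>- sin x / 2\<bar> \<le> 1 / 2" for x :: real
  using abs_sin_le_one[of x] by simp

lemma DL_small: "\<bar>hc x ^ l * DL l x\<bar> \<le> B + 2 * real l" if "1 \<le> l"
proof -
  have "hc x ^ l * DL l x = M1 x - real l * ((- sin x / 2) * (hc x ^ (l - 1) * Mq l x))"
    using DL_M1[of l x] by (simp add: algebra_simps)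
  moreover have "\<bar>(- sin x / 2) * (hc x ^ (l - 1) * Mq l x)\<bar> \<le> 1 / 2 * 4"
    unfolding abs_mult[of "- sin x / 2"] using Mq_small[OF that, of x] sin_half_le[of x] by (intro mult_mono) auto
  then have "\<bar>real l * ((- sin x / 2) * (hc x ^ (l - 1) * Mq l x))\<bar> \<le> real l * 2"
    unfolding abs_mult[of "real l"] by (simp only: abs_of_nat) (intro mult_left_mono, auto)
  ultimately show ?thesis using M1_le[of x] by linarith
qed

text \<open>This exponential bound serves only to make the supremum in \<open>gamma_l\<close>
  meaningful; the estimates use \<open>DL_small\<close>.\<close>

lemma DL_bounded: "\<bar>DL l x\<bar> \<le> (B + 2 * real l) * 4 ^ l" if "1 \<le> l"
proof (cases "cos x \<le> - 1 / 2")
  case True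
  then show ?thesis using B_ge by (simp add: Mq_pi)
next
  case False
  note h = hc_ge[OF False]
  have "(1 / 4) ^ l * \<bar>DL l x\<bar> \<le> hc x ^ l * \<bar>DL l x\<bar>"
    by (intro mult_right_mono power_mono h) auto
  also have "\<dots> = \<bar>hc x ^ l * DL l x\<bar>" using hc_bounds(1)[of x] by (simp add: abs_mult)
  also have "\<dots> \<le> B + 2 * real l" by (rule DL_small[OF that])
  finally show ?thesis by (simp add: power_divide field_simps)
qed

lemma M_shift: "M (x + 2 * pi * real_of_int n) = M x" "M1 (x + 2 * pi * real_of_int n) = M1 x"
  by (simp_all add: M_res M1_def res_shift)

lemma cos_sin_shift: "cos (x + 2 * pi * real_of_int n) = cos x" "sin (x + 2 * pi * real_of_int n) = sin x"
  using cos_sin_int_shift[of 1 x n] by simp_all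

lemma Mq_shift: "Mq l (x + 2 * pi * real_of_int n) = Mq l x" "DL l (x + 2 * pi * real_of_int n) = DL l x"
  by (simp_all add: Mq_eq DL_def hc_def M_shift cos_sin_shift)

lemma Mq_ends: "Mq l (- pi) = Mq l pi"
  by (simp add: Mq_pi)

lemma Mq_0: "Mq l 0 = 1"
proof -
  have "M 0 = 1" by (rule M_low) simp
  then show ?thesis unfolding Mq_eq hc_def by simp
qed

end

text \<open>A fixed l: \<open>l3\<close> makes \<open>l - 1\<close> at least 2, so the quadratic
  factor near pi survives differentiation, and \<open>alpha_half\<close> keeps the normalizing value
  \<open>U 0\<close> away from 0.\<close>

locale meyer_method = meyer +
  fixes lam :: "nat \<Rightarrow> nat \<Rightarrow> real" and nn :: "nat \<Rightarrow> nat" and l :: nat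
  assumes l3: "3 \<le> l"
    and alpha_half: "alpha_l \<theta> \<omega>0 lam nn l \<le> 1 / 2"
begin

abbreviation "U \<equiv> u_l \<theta> \<omega>0 lam nn l"
abbreviation "U1 \<equiv> u1_l \<theta> \<omega>0 lam nn l"
abbreviation "al \<equiv> alpha_l \<theta> \<omega>0 lam nn l"
abbreviation "ga \<equiv> gamma_l \<theta> \<omega>0 lam nn l"
abbreviation "mu \<equiv> mu_l \<theta> \<omega>0 lam nn l"
abbreviation "m \<equiv> mask_l \<theta> \<omega>0 lam nn l"

lemma U1_eq: "U1 = summ_method lam (nn l) (DL l)"
  by (simp add: u1_l_def Mq_deriv)

lemma U_der: "(U has_real_derivative U1 x) (at x)"
  unfolding U1_eq u_l_def by (rule summ_method_deriv[OF Mq_der Mq_ends])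

lemma res_Icc: "res x \<in> {-pi..pi}"
  using res_bounds[of x] by auto

lemma res_decomp: "x = res x + 2 * pi * real_of_int \<lfloor>(x + pi) / (2 * pi)\<rfloor>"
  by (simp add: res_def)

lemma U_close: "\<bar>U x - Mq l x\<bar> \<le> al" and al_nonneg: "0 \<le> al"
proof -
  have "continuous_on {-pi..pi} (\<lambda>x. U x - Mq l x)"
    by (auto intro!: continuous_intros continuous_at_imp_continuous_on DERIV_isCont[OF U_der] DERIV_isCont[OF Mq_der])
  then obtain b where b: "\<And>x. x \<in> {-pi..pi} \<Longrightarrow> \<bar>U x - Mq l x\<bar> \<le> b"
    using continuous_bounded_Icc by blast
  show "0 \<le> al" unfolding alpha_l_def by (rule Cnorm_nonneg[OF b])
  have "\<bar>U (res x) - Mq l (res x)\<bar> \<le> al"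
    unfolding alpha_l_def by (rule Cnorm_upper[OF b res_Icc])
  moreover have "U x = U (res x)" "Mq l x = Mq l (res x)"
    using summ_method_shift[of lam "nn l" "Mq l" "res x" "\<lfloor>(x + pi) / (2 * pi)\<rfloor>"]
      Mq_shift(1)[of l "res x" "\<lfloor>(x + pi) / (2 * pi)\<rfloor>"]
    unfolding res_decomp[of x, symmetric] u_l_def by simp_all
  ultimately show "\<bar>U x - Mq l x\<bar> \<le> al" by simp
qed

lemma U1_close: "\<bar>U1 x - DL l x\<bar> \<le> ga" and ga_nonneg: "0 \<le> ga"
proof -
  obtain b where b: "\<And>x. x \<in> {-pi..pi} \<Longrightarrow> \<bar>U1 x\<bar> \<le> b"
    using continuous_bounded_Icc[OF summ_method_cont, of "-pi" pi lam "nn l" "DL l"] unfolding U1_eq by blast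
  have "\<bar>U1 x - DL l x\<bar> \<le> b + (B + 2 * real l) * 4 ^ l" if "x \<in> {-pi..pi}" for x
    using b[OF that] DL_bounded[of l x] l3 by linarith
  note b' = this
  show "0 \<le> ga" unfolding gamma_l_def Mq_deriv by (rule Cnorm_nonneg[OF b'])
  have "\<bar>U1 (res x) - DL l (res x)\<bar> \<le> ga"
    unfolding gamma_l_def Mq_deriv by (rule Cnorm_upper[OF b' res_Icc])
  moreover have "U1 x = U1 (res x)" "DL l x = DL l (res x)"
    using summ_method_shift[of lam "nn l" "DL l" "res x" "\<lfloor>(x + pi) / (2 * pi)\<rfloor>"]
      Mq_shift(2)[of l "res x" "\<lfloor>(x + pi) / (2 * pi)\<rfloor>"]
    unfolding res_decomp[of x, symmetric] U1_eq by simp_all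
  ultimately show "\<bar>U1 x - DL l x\<bar> \<le> ga" by simp
qed

lemma U0: "\<bar>U 0 - 1\<bar> \<le> al" "1 / 2 \<le> U 0"
  using U_close[of 0] alpha_half by (auto simp: Mq_0)

lemma U0_inv: "0 < 1 / U 0" "1 / U 0 \<le> 2" "\<bar>1 / U 0 - 1\<bar> \<le> 2 * al"
proof -
  show 1: "0 < 1 / U 0" using U0 by simp
  have "1 / U 0 \<le> 1 / (1 / 2)" using U0 by (intro divide_left_mono) auto
  then show 2: "1 / U 0 \<le> 2" by simp
  have "1 / U 0 - 1 = (1 - U 0) * (1 / U 0)" using U0 by (simp add: field_simps)
  then have "\<bar>1 / U 0 - 1\<bar> = \<bar>1 - U 0\<bar> * (1 / U 0)" using 1 by (metis abs_mult abs_of_pos)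
  also have "\<dots> \<le> al * 2" using U0 1 2 by (intro mult_mono) auto
  finally show "\<bar>1 / U 0 - 1\<bar> \<le> 2 * al" by simp
qed

lemma mu_ge: "al \<le> mu" "real l * al \<le> mu" "ga \<le> mu" "0 \<le> mu" "real l * al + ga = mu"
proof -
  have "1 * al \<le> real l * al" using l3 al_nonneg by (intro mult_right_mono) auto
  then show "al \<le> mu" "real l * al \<le> mu" "ga \<le> mu" "0 \<le> mu" "real l * al + ga = mu"
    using al_nonneg ga_nonneg by (auto simp: mu_l_def)
qed

lemma m_eq: "m x = hc x ^ l * (U x * (1 / U 0))"
  by (simp add: mask_l_def hc_cos_half)

definition m1 :: "real \<Rightarrow> real" where
  "m1 x = real l * hc x ^ (l - 1) * (- sin x / 2) * (U x * (1 / U 0)) + hc x ^ l * (U1 x * (1 / U 0))"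

lemma m_der: "(m has_real_derivative m1 x) (at x)"
proof -
  have "((\<lambda>x. hc x ^ l * (U x * (1 / U 0))) has_real_derivative m1 x) (at x)"
    unfolding m1_def
    using DERIV_mult[OF hc_power_der DERIV_cmult_right[OF U_der, of "1 / U 0"]] by (simp only: mult_ac add_ac)
  then show ?thesis by (simp only: m_eq[symmetric])
qed

lemma m1_cont: "continuous_on UNIV m1"
proof -
  have "continuous_on UNIV U1" unfolding U1_eq by (rule summ_method_cont)
  moreover have "continuous_on UNIV U"
    by (auto intro!: continuous_at_imp_continuous_on DERIV_isCont[OF U_der])
  ultimately show ?thesis unfolding m1_def[abs_def] hc_def by (intro continuous_intros) auto
qed

lemma hc_power_le: "0 \<le> hc x ^ k" "hc x ^ k \<le> 1"
  using hc_bounds[of x] by (auto intro: power_le_one)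

text \<open>Approximation and normalization errors are kept apart. The second remains proportional
  to \<open>Mq\<close>, for which no bound uniform in l is available until it is multiplied by the
  power of \<open>hc\<close>.\<close>

lemma U_quot: "\<bar>U x * (1 / U 0) - Mq l x\<bar> \<le> 2 * al + 2 * al * \<bar>Mq l x\<bar>"
proof -
  have "U x * (1 / U 0) - Mq l x = (U x - Mq l x) * (1 / U 0) + Mq l x * (1 / U 0 - 1)"
    by (simp only: algebra_simps)
  moreover have "\<bar>(U x - Mq l x) * (1 / U 0)\<bar> \<le> al * 2"
    unfolding abs_mult[of "U x - Mq l x"] using U0_inv al_nonneg by (intro mult_mono U_close) auto
  moreover have "\<bar>Mq l x * (1 / U 0 - 1)\<bar> \<le> \<bar>Mq l x\<bar> * (2 * al)"
    unfolding abs_mult[of "Mq l x"] by (intro mult_left_mono U0_inv) auto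
  moreover have "\<bar>Mq l x\<bar> * (2 * al) = 2 * al * \<bar>Mq l x\<bar>" by simp
  ultimately show ?thesis
    using abs_triangle_ineq[of "(U x - Mq l x) * (1 / U 0)" "Mq l x * (1 / U 0 - 1)"] by linarith
qed

lemma U1_quot: "\<bar>U1 x * (1 / U 0) - DL l x\<bar> \<le> 2 * ga + 2 * al * \<bar>DL l x\<bar>"
proof -
  have "U1 x * (1 / U 0) - DL l x = (U1 x - DL l x) * (1 / U 0) + DL l x * (1 / U 0 - 1)"
    by (simp only: algebra_simps)
  moreover have "\<bar>(U1 x - DL l x) * (1 / U 0)\<bar> \<le> ga * 2"
    unfolding abs_mult[of "U1 x - DL l x"] using U0_inv ga_nonneg by (intro mult_mono U1_close) auto
  moreover have "\<bar>DL l x * (1 / U 0 - 1)\<bar> \<le> \<bar>DL l x\<bar> * (2 * al)"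
    unfolding abs_mult[of "DL l x"] by (intro mult_left_mono U0_inv) auto
  moreover have "\<bar>DL l x\<bar> * (2 * al) = 2 * al * \<bar>DL l x\<bar>" by simp
  ultimately show ?thesis
    using abs_triangle_ineq[of "(U1 x - DL l x) * (1 / U 0)" "DL l x * (1 / U 0 - 1)"] by linarith
qed

lemma m_close: "\<bar>m x - M x\<bar> \<le> 11 * B * mu"
proof -
  have "m x - M x = hc x ^ l * (U x * (1 / U 0) - Mq l x)"
    unfolding m_eq Mq_M[of x l, symmetric] by (simp only: right_diff_distrib)
  then have "\<bar>m x - M x\<bar> = hc x ^ l * \<bar>U x * (1 / U 0) - Mq l x\<bar>"
    using hc_power_le(1)[of x l] by (simp only: abs_mult abs_of_nonneg)
  also have "\<dots> \<le> hc x ^ l * (2 * al + 2 * al * \<bar>Mq l x\<bar>)"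
    by (intro mult_left_mono U_quot hc_power_le)
  also have "\<dots> = hc x ^ l * (2 * al) + 2 * al * \<bar>hc x ^ l * Mq l x\<bar>"
    using hc_power_le(1)[of x l] by (simp add: abs_mult algebra_simps)
  also have "\<dots> \<le> 1 * (2 * al) + 2 * al * 1"
    unfolding Mq_M using al_nonneg by (intro add_mono mult_right_mono mult_left_mono hc_power_le M_le) auto
  also have "\<dots> \<le> 4 * mu" using mu_ge by simp
  also have "\<dots> \<le> 11 * B * mu" using mu_ge B_ge by (intro mult_right_mono) auto
  finally show ?thesis .
qed

text \<open>The errors sum to at most \<open>9 * real l * al + 2 * ga + 2 * B * al\<close>, hence to
  \<open>(9 + 2 * B) * mu\<close>; this is the origin of the constant 11.\<close>

lemma m1_close: "\<bar>m1 x - M1 x\<bar> \<le> 11 * B * mu"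
proof -
  let ?s = "- sin x / 2" and ?u = "U x * (1 / U 0) - Mq l x" and ?v = "U1 x * (1 / U 0) - DL l x"
  have l1: "1 \<le> l" using l3 by simp
  have "m1 x - M1 x = real l * (?s * (hc x ^ (l - 1) * ?u)) + hc x ^ l * ?v"
    unfolding m1_def DL_M1[of l x, symmetric] by (simp only: algebra_simps)
  moreover have "\<bar>real l * (?s * (hc x ^ (l - 1) * ?u))\<bar> \<le> real l * (1 / 2 * (10 * al))"
  proof -
    have "\<bar>hc x ^ (l - 1) * ?u\<bar> = hc x ^ (l - 1) * \<bar>?u\<bar>"
      using hc_power_le(1)[of x "l - 1"] by (simp only: abs_mult abs_of_nonneg)
    also have "\<dots> \<le> hc x ^ (l - 1) * (2 * al + 2 * al * \<bar>Mq l x\<bar>)"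
      by (intro mult_left_mono U_quot hc_power_le)
    also have "\<dots> = hc x ^ (l - 1) * (2 * al) + 2 * al * \<bar>hc x ^ (l - 1) * Mq l x\<bar>"
      using hc_power_le(1)[of x "l - 1"] by (simp add: abs_mult algebra_simps)
    also have "\<dots> \<le> 1 * (2 * al) + 2 * al * 4"
      using al_nonneg by (intro add_mono mult_right_mono mult_left_mono hc_power_le Mq_small l1) auto
    finally have "\<bar>hc x ^ (l - 1) * ?u\<bar> \<le> 10 * al" by simp
    then have "\<bar>?s * (hc x ^ (l - 1) * ?u)\<bar> \<le> 1 / 2 * (10 * al)"
      unfolding abs_mult[of ?s] using sin_half_le by (intro mult_mono) auto
    then show ?thesis unfolding abs_mult[of "real l"] by (simp only: abs_of_nat) (intro mult_left_mono, auto)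
  qed
  moreover have "\<bar>hc x ^ l * ?v\<bar> \<le> 2 * ga + 2 * al * (B + 2 * real l)"
  proof -
    have "\<bar>hc x ^ l * ?v\<bar> = hc x ^ l * \<bar>?v\<bar>"
      using hc_power_le(1)[of x l] by (simp only: abs_mult abs_of_nonneg)
    also have "\<dots> \<le> hc x ^ l * (2 * ga + 2 * al * \<bar>DL l x\<bar>)"
      by (intro mult_left_mono U1_quot hc_power_le)
    also have "\<dots> = hc x ^ l * (2 * ga) + 2 * al * \<bar>hc x ^ l * DL l x\<bar>"
      using hc_power_le(1)[of x l] by (simp add: abs_mult algebra_simps)
    also have "\<dots> \<le> 1 * (2 * ga) + 2 * al * (B + 2 * real l)"
      using al_nonneg ga_nonneg by (intro add_mono mult_right_mono mult_left_mono hc_power_le DL_small l1) auto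
    finally show ?thesis by simp
  qed
  moreover have "2 * al * (B + 2 * real l) = 2 * (B * al) + 4 * (real l * al)" by (simp add: algebra_simps)
  moreover have "B * al \<le> B * mu" "2 * mu \<le> B * mu"
    using mu_ge B_ge by (auto intro!: mult_left_mono mult_right_mono)
  moreover have "real l * (1 / 2 * (10 * al)) = 5 * (real l * al)" by simp
  moreover have "11 * B * mu = 11 * (B * mu)" by simp
  ultimately show ?thesis
    using abs_triangle_ineq[of "real l * (?s * (hc x ^ (l - 1) * ?u))" "hc x ^ l * ?v"] mu_ge by linarith
qed

lemma hc_power_mono: "2 \<le> k \<Longrightarrow> hc x ^ k \<le> (hc x)\<^sup>2"
  using hc_bounds[of x] by (intro power_decreasing)

text \<open>Here \<open>Mq l\<close> and \<open>DL l\<close> vanish, so \<open>U\<close> and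
  \<open>U1\<close> consist of approximation error alone, and the powers of \<open>hc\<close> are at
  most its square.\<close>

lemma m_pi:
  assumes "cos x \<le> - 1 / 2"
  shows "\<bar>m x\<bar> \<le> 11 * B * mu * ((1 + cos x) / 2)\<^sup>2" "\<bar>m1 x\<bar> \<le> 11 * B * mu * ((1 + cos x) / 2)\<^sup>2"
proof -
  let ?c = "(hc x)\<^sup>2" and ?s = "- sin x / 2" and ?u = "U x * (1 / U 0)" and ?v = "U1 x * (1 / U 0)"
  have u: "\<bar>?u\<bar> \<le> 2 * al" "\<bar>?v\<bar> \<le> 2 * ga"
    using U_quot[of x] U1_quot[of x]
    by (simp_all only: Mq_pi[OF assms] diff_0_right abs_zero mult_zero_right add_0_right)
  have c: "hc x ^ l \<le> ?c" "hc x ^ (l - 1) \<le> ?c" using l3 by (auto intro: hc_power_mono)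
  have c0: "0 \<le> ?c" by simp
  have 1: "\<bar>hc x ^ l * ?u\<bar> \<le> ?c * (2 * al)" "\<bar>hc x ^ l * ?v\<bar> \<le> ?c * (2 * ga)"
    "\<bar>hc x ^ (l - 1) * ?u\<bar> \<le> ?c * (2 * al)"
    unfolding abs_mult[of "hc x ^ l"] abs_mult[of "hc x ^ (l - 1)"] abs_of_nonneg[OF hc_power_le(1)]
    using u c c0 by (intro mult_mono; simp)+
  have "\<bar>?s * (hc x ^ (l - 1) * ?u)\<bar> \<le> 1 / 2 * (?c * (2 * al))"
    unfolding abs_mult[of ?s] using sin_half_le 1(3) by (intro mult_mono) auto
  then have 2: "\<bar>real l * (?s * (hc x ^ (l - 1) * ?u))\<bar> \<le> real l * (1 / 2 * (?c * (2 * al)))"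
    unfolding abs_mult[of "real l"] by (simp only: abs_of_nat) (intro mult_left_mono, auto)
  have e: "m1 x = real l * (?s * (hc x ^ (l - 1) * ?u)) + hc x ^ l * ?v"
    unfolding m1_def by (simp only: mult_ac)
  have "\<bar>m1 x\<bar> \<le> real l * (1 / 2 * (?c * (2 * al))) + ?c * (2 * ga)"
    unfolding e by (rule order_trans[OF abs_triangle_ineq add_mono[OF 2 1(2)]])
  also have "\<dots> = ?c * (real l * al + 2 * ga)" by (simp add: algebra_simps)
  also have "\<dots> \<le> ?c * (2 * mu)" using mu_ge al_nonneg by (intro mult_left_mono) auto
  finally have m1: "\<bar>m1 x\<bar> \<le> ?c * (2 * mu)" .
  have "\<bar>m x\<bar> \<le> ?c * (2 * al)" using 1(1) by (simp only: m_eq)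
  also have "\<dots> \<le> ?c * (2 * mu)" using mu_ge by (intro mult_left_mono) auto
  finally have m: "\<bar>m x\<bar> \<le> ?c * (2 * mu)" .
  have "?c * (2 * mu) \<le> ?c * (11 * B * mu)"
    using mu_ge B_ge by (intro mult_left_mono mult_right_mono) auto
  with m m1 show "\<bar>m x\<bar> \<le> 11 * B * mu * ((1 + cos x) / 2)\<^sup>2" "\<bar>m1 x\<bar> \<le> 11 * B * mu * ((1 + cos x) / 2)\<^sup>2"
    by (simp_all add: hc_def[symmetric] mult.commute)
qed

lemma mask_perturb_mask_l:
  assumes "11 * B * mu \<le> 1 / 100"
  shows "mask_perturb M M1 H H1 m m1 B (11 * B * mu)"
proof
  show "0 \<le> 11 * B * mu" using mu_ge B_ge by simp
  show "m 0 = 1" using U0 by (simp add: mask_l_def)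
qed (use assms M_le M1_le B_ge m_close m1_close m_pi M_low M1_low H_eq_M H1_eq_M1 H_hi H1_hi m_der m1_cont in auto)

end

theorem theorem6:
  fixes \<theta> :: "real \<Rightarrow> real" and \<omega>0 :: real
    and lam :: "nat \<Rightarrow> nat \<Rightarrow> real" and nn :: "nat \<Rightarrow> nat" and l0 :: nat and c :: real
  assumes theta_odd: "\<And>x. \<theta> (- x) = - \<theta> x"
    and theta_mono: "mono \<theta>"
    and theta_C2: "C2_real \<theta>"
    and theta_const: "\<And>x. x > pi / 3 \<Longrightarrow> \<theta> x = pi / 4"
    and omega0: "pi / 3 \<le> \<omega>0" "\<omega>0 < pi / 2"
    and alpha_small: "alpha_l \<theta> \<omega>0 lam nn \<in> o[sequentially](\<lambda>l. 1 / real l)"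
    and gamma_small: "gamma_l \<theta> \<omega>0 lam nn \<in> o[sequentially](\<lambda>l. 1)"
    and u_pi: "\<And>l. u_l \<theta> \<omega>0 lam nn l pi \<noteq> 0"
    and c_def: "c = (INF l\<in>{l0..}. \<bar>u_l \<theta> \<omega>0 lam nn l 0\<bar>)"
    and c_pos: "c > 0"
  shows "(\<lambda>l. \<bar>time_radius_sq (phi_orth_l \<theta> \<omega>0 lam nn l) - time_radius_sq (meyer_phi \<theta> \<omega>0)\<bar>)
     \<in> O[sequentially](\<lambda>l. max (mu_l \<theta> \<omega>0 lam nn l)
          (real l * C0_const \<omega>0 powr (- real l + 2 * log 2 ((1 + eps_l \<theta> \<omega>0 lam nn l) / c))))"
proof -
  interpret meyer \<theta> \<omega>0 using theta_odd theta_C2 theta_const omega0 by unfold_locales auto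
  let ?al = "alpha_l \<theta> \<omega>0 lam nn" and ?ga = "gamma_l \<theta> \<omega>0 lam nn" and ?mu = "mu_l \<theta> \<omega>0 lam nn"
  have K1: "1 \<le> 26 * B" using B_ge by simp
  show ?thesis
  proof (rule time_radius_sq_orth_stable[OF H_der H1_cont H_dec H1_dec K1 H_orth H_pos])
    fix D0 L
    assume D0: "0 < D0" "0 \<le> L" and stable: "\<And>\<phi> \<phi>1 D. \<lbrakk>\<And>x. (\<phi> has_real_derivative \<phi>1 x) (at x); continuous_on UNIV \<phi>1;
        \<And>x. \<bar>\<phi> x - H x\<bar> \<le> D / (1 + x\<^sup>2); \<And>x. \<bar>\<phi>1 x - H1 x\<bar> \<le> D / (1 + x\<^sup>2); 0 \<le> D; D \<le> D0\<rbrakk> \<Longrightarrow>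
        \<bar>time_radius_sq (inv_fourier (\<lambda>x. complex_of_real (\<phi> x / sqrt (per (\<lambda>x. (\<phi> x)\<^sup>2) x)))) -
         time_radius_sq (inv_fourier (\<lambda>x. complex_of_real (H x)))\<bar> \<le> L * D"
    have la: "(\<lambda>l. real l * ?al l) \<longlonglongrightarrow> 0"
    proof -
      have "(\<lambda>l. ?al l / (1 / real l)) \<longlonglongrightarrow> 0" by (rule smalloD_tendsto[OF alpha_small])
      then show ?thesis by (simp add: mult.commute)
    qed
    have ga: "?ga \<longlonglongrightarrow> 0" using smalloD_tendsto[OF gamma_small] by simp
    have mu: "?mu \<longlonglongrightarrow> 0" using tendsto_add[OF la ga] by (simp add: mu_l_def[abs_def])
    \<comment> \<open>The bound of \<open>phi_approx\<close> for the mask error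
      \<open>E = 11 * B * ?mu l\<close>.\<close>
    define D where "D l = 11000 * B * (11 * B * ?mu l)" for l
    have "(\<lambda>l. 11 * B * ?mu l) \<longlonglongrightarrow> 11 * B * 0" by (intro tendsto_intros mu)
    then have e1: "\<forall>\<^sub>F l in sequentially. 11 * B * ?mu l < 1 / 100" by (rule order_tendstoD) simp
    have "D \<longlonglongrightarrow> 11000 * B * (11 * B * 0)" unfolding D_def by (intro tendsto_intros mu)
    then have e2: "\<forall>\<^sub>F l in sequentially. D l < D0" by (rule order_tendstoD) (use D0 in simp)
    have e3: "\<forall>\<^sub>F l in sequentially. real l * ?al l < 1 / 2" using la by (rule order_tendstoD) simp
    have "\<forall>\<^sub>F l in sequentially. norm \<bar>time_radius_sq (phi_orth_l \<theta> \<omega>0 lam nn l) - time_radius_sq (meyer_phi \<theta> \<omega>0)\<bar>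
       \<le> (L * (11000 * B * (11 * B))) * norm (max (?mu l)
            (real l * C0_const \<omega>0 powr (- real l + 2 * log 2 ((1 + eps_l \<theta> \<omega>0 lam nn l) / c))))"
      using e1 e2 e3 eventually_ge_at_top[of 3]
    proof eventually_elim
      case (elim l)
      have "?al l \<le> 1 / 2"
      \<comment> \<open>Nonnegativity of \<open>?al l\<close> is available only inside
        \<open>meyer_method\<close>, whose assumptions are still being checked.\<close>
      proof (cases "0 \<le> ?al l")
        case True
        then have "1 * ?al l \<le> real l * ?al l" using elim(4) by (intro mult_right_mono) auto
        then show ?thesis using elim(3) by linarith
      qed simp
      then interpret W: meyer_method \<theta> \<omega>0 lam nn l using elim(4) by unfold_locales
      interpret P: mask_perturb M M1 H H1 W.m W.m1 B "11 * B * ?mu l"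
        by (rule W.mask_perturb_mask_l) (use elim(1) in simp)
      have phi: "phi_hat_l \<theta> \<omega>0 lam nn l = P.phi"
        by (simp add: fun_eq_iff phi_hat_l_def P.phi_def)
      have "\<bar>time_radius_sq (inv_fourier (\<lambda>x. complex_of_real (P.phi x / sqrt (per (\<lambda>x. (P.phi x)\<^sup>2) x)))) -
         time_radius_sq (inv_fourier (\<lambda>x. complex_of_real (H x)))\<bar> \<le> L * D l"
        by (rule stable[OF P.phi_deriv P.phi1_cont])
           (use P.phi_approx elim(2) W.mu_ge B_ge in \<open>auto simp: D_def\<close>)
      moreover have "phi_orth_l \<theta> \<omega>0 lam nn l = inv_fourier (\<lambda>x. complex_of_real (P.phi x / sqrt (per (\<lambda>x. (P.phi x)\<^sup>2) x)))"
        by (simp add: phi_orth_l_def phi_orth_hat_l_def phi Phi_l_def per_def)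
      moreover have "meyer_phi \<theta> \<omega>0 = inv_fourier (\<lambda>x. complex_of_real (H x))" by (simp add: meyer_phi_def)
      ultimately have "\<bar>time_radius_sq (phi_orth_l \<theta> \<omega>0 lam nn l) - time_radius_sq (meyer_phi \<theta> \<omega>0)\<bar> \<le> (L * (11000 * B * (11 * B))) * ?mu l"
        by (simp add: D_def mult_ac)
      also have "\<dots> \<le> (L * (11000 * B * (11 * B))) * norm (max (?mu l)
            (real l * C0_const \<omega>0 powr (- real l + 2 * log 2 ((1 + eps_l \<theta> \<omega>0 lam nn l) / c))))"
        using D0 B_ge by (intro mult_left_mono) auto
      finally show ?case by simp
    qed
    then show ?thesis by (rule bigoI)
  qed
qed

end
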